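(* Let $n,r$ be integers with $n>2r\ge 2$. The bipartite Kneser graph $H(n,r)$ is norming if and only if $(n,r)=(3,1)$ (in which case $H(3,1)$ is the $6$-cycle).
   Context: For $n>k>r>0$, the set-inclusion graph $I(n,k,r)$ is the bipartite graph with parts $\binom{[n]}{k}$ and $\binom{[n]}{r}$ (the $k$-subsets and $r$-subsets of $[n]=\{1,\dots,n\}$), where a $k$-set $X$ is adjacent to an $r$-set $Y$ iff $Y\subseteq X$. The bipartite Kneser graph is $H(n,r)=I(n,n-r,r)$. For a bipartite graph $H$ with bipartition $A\cup B$ and edges $(u,v)$, $u\in A$, $v\in B$, let $t_H(f)=\int\prod_{(u,v)\in E(H)}f(x_u,y_v)$ for bounded measurable $f:[0,1]^2\to\mathbb{R}$ (variables $x_u,y_v\in[0,1]$, Lebesgue measure). $H$ is norming (= real-norming) if $f\mapsto|t_H(f)|^{1/|E(H)|}$ is a seminorm on the space of such $f$ vanishing only on functions that are $0$ a.e. *)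

theory Defs
  imports "HOL-Analysis.Analysis"
begin

text \<open>
  A bipartite graph comes with an ordered bipartition, and its edges are pairs whose first
  component lies in the left part.
\<close>

record 'a bigraph =
  left_part :: "'a set"
  right_part :: "'a set"
  edges :: "('a \<times> 'a) set"

definition set_inclusion_graph :: "nat \<Rightarrow> nat \<Rightarrow> nat \<Rightarrow> nat set bigraph" where
  "set_inclusion_graph n k r =
    \<lparr>left_part = {X. X \<subseteq> {1..n} \<and> card X = k},
     right_part = {Y. Y \<subseteq> {1..n} \<and> card Y = r},
     edges = {(X, Y). X \<subseteq> {1..n} \<and> card X = k \<and> Y \<subseteq> {1..n} \<and> card Y = r \<and> Y \<subseteq> X}\<rparr>"

definition bipartite_kneser :: "nat \<Rightarrow> nat \<Rightarrow> nat set bigraph" where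
  "bipartite_kneser n r = set_inclusion_graph n (n - r) r"

definition adjacent :: "'a bigraph \<Rightarrow> 'a \<Rightarrow> 'a \<Rightarrow> bool" where
  "adjacent H u v \<longleftrightarrow> (u, v) \<in> edges H \<or> (v, u) \<in> edges H"

text \<open>
  The underlying graph of \<open>H\<close> is isomorphic to the cycle on the vertices \<open>0, \<dots>, m - 1\<close>
  (a simple graph for \<open>m \<ge> 3\<close>). The two parts must be disjoint for their union to be the
  vertex set.
\<close>

definition is_cycle :: "nat \<Rightarrow> 'a bigraph \<Rightarrow> bool" where
  "is_cycle m H \<longleftrightarrow>
    left_part H \<inter> right_part H = {} \<and>
    (\<exists>\<phi>. bij_betw \<phi> {..<m} (left_part H \<union> right_part H) \<and>
         (\<forall>i<m. \<forall>j<m. adjacent H (\<phi> i) (\<phi> j) \<longleftrightarrow> j = Suc i mod m \<or> i = Suc j mod m))"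

definition unit_interval :: "real measure" where
  "unit_interval = restrict_space lborel {0..1}"

abbreviation unit_square :: "(real \<times> real) measure" where
  "unit_square \<equiv> unit_interval \<Otimes>\<^sub>M unit_interval"

text \<open>
  The bounded measurable functions on the unit square. Measurable means Borel measurable; every
  Lebesgue measurable function agrees almost everywhere with a Borel one, so this does not affect
  the densities below. Values outside the square are irrelevant.
\<close>

definition kernels :: "(real \<times> real \<Rightarrow> real) set" where
  "kernels = {f \<in> borel_measurable unit_square. bounded (f ` ({0..1} \<times> {0..1}))}"

definition hom_density :: "'a bigraph \<Rightarrow> (real \<times> real \<Rightarrow> real) \<Rightarrow> real" where
  "hom_density H f =
    (\<integral>(x, y). (\<Prod>(u, v)\<in>edges H. f (x u, y v))
      \<partial>((\<Pi>\<^sub>M u\<in>left_part H. unit_interval) \<Otimes>\<^sub>M (\<Pi>\<^sub>M v\<in>right_part H. unit_interval)))"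

definition graph_norm :: "'a bigraph \<Rightarrow> (real \<times> real \<Rightarrow> real) \<Rightarrow> real" where
  "graph_norm H f = \<bar>hom_density H f\<bar> powr (1 / real (card (edges H)))"

definition seminorm_on :: "('b \<Rightarrow> real) set \<Rightarrow> (('b \<Rightarrow> real) \<Rightarrow> real) \<Rightarrow> bool" where
  "seminorm_on V N \<longleftrightarrow>
    (\<forall>f\<in>V. 0 \<le> N f) \<and>
    (\<forall>f\<in>V. \<forall>c. N (\<lambda>z. c * f z) = \<bar>c\<bar> * N f) \<and>
    (\<forall>f\<in>V. \<forall>g\<in>V. N (\<lambda>z. f z + g z) \<le> N f + N g)"

definition norming :: "'a bigraph \<Rightarrow> bool" where
  "norming H \<longleftrightarrow>
    seminorm_on kernels (graph_norm H) \<and>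
    (\<forall>f\<in>kernels. graph_norm H f = 0 \<longrightarrow> (AE z in unit_square. f z = 0))"

end

theory Submission
  imports Defs "HOL-Probability.Probability"
begin

text \<open>
  The 6-cycle: its density is \<open>tr((f f\<^sup>t)\<^sup>3)\<close>, the sixth power of the Schatten 6-norm. Repeated
  Cauchy--Schwarz inequalities (reflections of the cycle) give a Hoelder inequality for six
  different kernels, and the triangle inequality follows from it.

  All other cases: let \<open>x\<close> be a uniform colour in \<open>{..<q}\<close>, let \<open>y\<close> be a uniform function from
  colours to four points, and consider \<open>f(y, x) = \<phi>(y(x))\<close>. If \<open>\<phi>\<close> is one of the three nontrivial
  characters of the Klein four-group, the density of \<open>f\<close> is the probability that a random
  colouring of the \<open>r\<close>-sets is even, i.e. uses every colour an even number of times below every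
  \<open>(n - r)\<close>-set. Every colour class of an even colouring has at least \<open>r + 2\<close> members, and not all of
  them have exactly \<open>r + 2\<close>, since those would be stars \<open>{A \<union> {y}}\<close> forming a Steiner system that
  does not exist. So an even colouring has \<open>D < L / (r + 2)\<close> colours, \<open>L\<close> being the number of
  \<open>r\<close>-sets, and the density is of order \<open>q ^ D / q ^ L\<close> at most. The three characters multiply to 1, so that a
  sum of them does not need evenness: it only needs that no colour occurs exactly once. A star \<open>T\<close>
  with \<open>r + 2\<close> members has this property. Hence \<open>1 + \<beta> (f\<^sub>1 + f\<^sub>2 + f\<^sub>3)\<close>, where \<open>\<beta>\<close> is the
  inverse of the common norm of the \<open>f\<^sub>i\<close>, has large density from the colourings that are constant
  on \<open>T\<close>, while the triangle inequality bounds its norm by 4. This is a contradiction for large \<open>q\<close>.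
\<close>

section \<open>Even families of sets\<close>

text \<open>This says that the indicator of \<open>T\<close> lies in the kernel, over the field with
  two elements, of the inclusion matrix between (n - r)-sets and r-sets. The colour classes of an
  even colouring are such families.\<close>

definition even_family :: "nat \<Rightarrow> nat \<Rightarrow> nat set set \<Rightarrow> bool" where
  "even_family n r T \<longleftrightarrow>
    (\<forall>Y\<in>T. Y \<subseteq> {1..n} \<and> card Y = r) \<and>
    (\<forall>X. X \<subseteq> {1..n} \<and> card X = n - r \<longrightarrow> even (card {Y\<in>T. Y \<subseteq> X}))"

lemma card_pos_obtain:
  assumes "0 < card A"
  obtains x where "x \<in> A"
  using assms by (metis card_gt_0_iff ex_in_conv)

lemma even_family_finite: "even_family n r T \<Longrightarrow> finite T"
  by (rule finite_subset[of _ "Pow {1..n}"]) (auto simp: even_family_def)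

text \<open>The members that miss \<open>Z\<close> are those below its complement, which is an (n -
  r)-set and so contains an even number of them. \<open>Y\<close> is one of these; discarding it
  leaves an odd number.\<close>

lemma even_family_odd_missed:
  assumes "even_family n r T" "Y \<in> T" "Z \<subseteq> {1..n} - Y" "card Z = r"
  shows "odd (card {Y'\<in>T - {Y}. Y' \<inter> Z = {}})"
proof -
  let ?X = "{1..n} - Z" and ?M = "{Y'\<in>T - {Y}. Y' \<inter> Z = {}}"
  have fin: "finite T" by (rule even_family_finite[OF assms(1)])
  have "finite Z" using assms(3) by (rule finite_subset) simp
  moreover have "Z \<subseteq> {1..n}" using assms(3) by blast
  ultimately have "card ?X = n - r" using assms(4) by (simp add: card_Diff_subset)
  hence "even (card {Y'\<in>T. Y' \<subseteq> ?X})"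
    using assms(1) unfolding even_family_def by auto
  moreover have "{Y'\<in>T. Y' \<subseteq> ?X} = insert Y ?M"
    using assms unfolding even_family_def by auto
  moreover have "card (insert Y ?M) = Suc (card ?M)" using fin by simp
  ultimately show ?thesis by simp
qed

text \<open>Extending a transversal of size at most \<open>r\<close> to an \<open>r\<close>-set would leave no missed member.\<close>

lemma even_family_no_small_transversal:
  assumes "even_family n r T" "Y \<in> T" "2 * r \<le> n" "V \<subseteq> {1..n} - Y" "card V \<le> r"
  obtains Y' where "Y' \<in> T - {Y}" "Y' \<inter> V = {}"
proof -
  have Y: "Y \<subseteq> {1..n}" "card Y = r" using assms(1,2) by (auto simp: even_family_def)
  moreover have "finite Y" using Y(1) by (rule finite_subset) simp
  ultimately have "card ({1..n} - Y) = n - r" by (simp add: card_Diff_subset)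
  hence "r \<le> card ({1..n} - Y)" using assms(3) by simp
  from exists_subset_between[OF assms(5) this assms(4)]
  obtain Z where Z: "V \<subseteq> Z" "Z \<subseteq> {1..n} - Y" "card Z = r"
    by (meson finite_Diff finite_atLeastAtMost)
  have "odd (card {Y'\<in>T - {Y}. Y' \<inter> Z = {}})"
    by (rule even_family_odd_missed[OF assms(1,2) Z(2,3)])
  hence "0 < card {Y'\<in>T - {Y}. Y' \<inter> Z = {}}" by (rule odd_pos)
  then obtain Y' where "Y' \<in> {Y'\<in>T - {Y}. Y' \<inter> Z = {}}" by (rule card_pos_obtain)
  hence "Y' \<in> T - {Y}" "Y' \<inter> Z = {}" by simp_all
  with Z(1) that show ?thesis by blast
qed

text \<open>Distinct sets of equal size are not nested, so every other member has a point outside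
  \<open>Y\<close>. Such points are the raw material for transversals that avoid
  \<open>Y\<close>.\<close>

lemma even_family_representatives:
  assumes "even_family n r T" "Y \<in> T"
  obtains e where "\<And>Y'. Y' \<in> T - {Y} \<Longrightarrow> e Y' \<in> Y' - Y"
proof -
  have "\<exists>x. x \<in> Y' - Y" if "Y' \<in> T - {Y}" for Y'
  proof (rule ccontr)
    assume "\<not> ?thesis"
    hence "Y' \<subseteq> Y" by blast
    moreover have "card Y' = card Y" "finite Y"
      using assms that finite_subset[of Y "{1..n}"] unfolding even_family_def by simp_all
    ultimately have "Y' = Y" by (simp add: card_subset_eq)
    thus False using that by simp
  qed
  thus ?thesis using that by metis
qed

text \<open>With at most r + 1 members, one representative outside \<open>Y\<close> for each member
  other than \<open>Y\<close> gives a transversal of at most r points, which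
  \<open>even_family_no_small_transversal\<close> forbids.\<close>

lemma even_family_card_ge:
  assumes "even_family n r T" "T \<noteq> {}" "2 * r \<le> n"
  shows "r + 2 \<le> card T"
proof (rule ccontr)
  assume less: "\<not> ?thesis"
  obtain Y where Y: "Y \<in> T" using assms(2) by blast
  have fin: "finite T" by (rule even_family_finite[OF assms(1)])
  obtain e where e: "\<And>Y'. Y' \<in> T - {Y} \<Longrightarrow> e Y' \<in> Y' - Y"
    using even_family_representatives[OF assms(1) Y] by metis
  have "card (T - {Y}) \<le> r" using less Y fin by (simp add: card_Diff_singleton)
  hence "card (e ` (T - {Y})) \<le> r" using fin card_image_le[of "T - {Y}" e] by simp
  moreover have "e ` (T - {Y}) \<subseteq> {1..n} - Y"
    using e assms(1) unfolding even_family_def by blast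
  ultimately obtain Y' where "Y' \<in> T - {Y}" "Y' \<inter> e ` (T - {Y}) = {}"
    using even_family_no_small_transversal[OF assms(1) Y assms(3)] by metis
  thus False using e by blast
qed

section \<open>Even families with exactly r + 2 members\<close>

text \<open>A point common to \<open>Y1\<close> and \<open>Y2\<close> but outside \<open>Y\<close>
  can represent both, so that r points would meet all r + 1 members other than
  \<open>Y\<close>.\<close>

lemma even_family_minimal_disjoint:
  assumes T: "even_family n r T" and card: "card T = r + 2" and n: "2 * r \<le> n"
    and Y: "Y \<in> T" "Y1 \<in> T - {Y}" "Y2 \<in> T - {Y}" "Y1 \<noteq> Y2"
  shows "Y1 \<inter> Y2 \<subseteq> Y"
proof (rule ccontr)
  assume "\<not> ?thesis"
  then obtain x where x: "x \<in> Y1" "x \<in> Y2" "x \<notin> Y" by blast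
  have fin: "finite T" by (rule even_family_finite[OF T])
  obtain e0 where e0: "\<And>Y'. Y' \<in> T - {Y} \<Longrightarrow> e0 Y' \<in> Y' - Y"
    using even_family_representatives[OF T Y(1)] by metis
  define e where "e = e0(Y1 := x)"
  have e: "e Y' \<in> Y' - Y" if "Y' \<in> T - {Y}" for Y'
    using e0[OF that] x by (auto simp: e_def)
  let ?V = "e ` (T - {Y, Y2})"
  have "card (T - {Y, Y2}) = r"
    using card Y card_Diff_subset[of "{Y, Y2}" T] by (cases "Y = Y2") simp_all
  hence "card ?V \<le> r" using fin card_image_le[of "T - {Y, Y2}" e] by simp
  moreover have "?V \<subseteq> {1..n} - Y"
    using e T unfolding even_family_def by blast
  ultimately obtain Y' where Y': "Y' \<in> T - {Y}" "Y' \<inter> ?V = {}"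
    using even_family_no_small_transversal[OF T Y(1) n] by metis
  show False
  proof (cases "Y' = Y2")
    case True
    have "x \<in> ?V" using Y by (auto simp: e_def image_iff intro!: bexI[of _ Y1])
    thus False using True Y' x by blast
  next
    case False
    hence "e Y' \<in> ?V" using Y' by blast
    thus False using e[OF Y'(1)] Y' by blast
  qed
qed

text \<open>By \<open>even_family_minimal_disjoint\<close> the other r + 1 members have disjoint
  traces outside \<open>Y\<close>. The key is that every point outside \<open>Y\<close> represents
  one of them (\<open>cover\<close>): this bounds n - r by r + 1, and a trace with two points would
  contain the representative of another member.\<close>

lemma even_family_minimal:
  assumes T: "even_family n r T" and card: "card T = r + 2" and n: "2 * r < n" and r: "1 \<le> r"
    and Y: "Y \<in> T" "Y1 \<in> T - {Y}"
  shows "n = 2 * r + 1" "card (Y1 - Y) = 1"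
proof -
  have fin: "finite T" by (rule even_family_finite[OF T])
  have sub: "Y' \<subseteq> {1..n}" "card Y' = r" if "Y' \<in> T" for Y'
    using T that by (auto simp: even_family_def)
  obtain e where e: "\<And>Y'. Y' \<in> T - {Y} \<Longrightarrow> e Y' \<in> Y' - Y"
    using even_family_representatives[OF T Y(1)] by metis
  let ?U = "T - {Y}"
  have cU: "card ?U = r + 1" using card Y fin by simp
  have disj: "e Y' \<notin> Y''" if "Y' \<in> ?U" "Y'' \<in> ?U" "Y' \<noteq> Y''" for Y' Y''
    using even_family_minimal_disjoint[OF T card _ Y(1) that] e[OF that(1)] n by auto
  have inj: "inj_on e ?U" using disj e by (metis DiffD1 inj_onI)
  \<comment> \<open>If \<open>w\<close> were no representative, then \<open>w\<close> and the
    representatives of r - 1 members \<open>J\<close>, among them any member through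
    \<open>w\<close>, would form an r-set that misses exactly the two members of \<open>?U\<close>
    outside \<open>J\<close>, against oddness.\<close>
  have cover: "w \<in> e ` ?U" if w: "w \<in> {1..n} - Y" for w
  proof (rule ccontr)
    assume nw: "w \<notin> e ` ?U"
    have "\<exists>J. J \<subseteq> ?U \<and> card J = r - 1 \<and> (\<forall>Y'\<in>?U. w \<in> Y' \<longrightarrow> Y' \<in> J)"
    proof (cases "\<exists>Y'\<in>?U. w \<in> Y'")
      case True
      then obtain Y' where Y': "Y' \<in> ?U" "w \<in> Y'" by blast
      have only: "Y'' = Y'" if "Y'' \<in> ?U" "w \<in> Y''" for Y''
        using even_family_minimal_disjoint[OF T card _ Y(1) that(1) Y'(1)] that(2) Y' w n by auto
      \<comment> \<open>The two distinct points \<open>w\<close> and \<open>e Y'\<close> of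
        \<open>Y'\<close> force r \<ge> 2, so \<open>J\<close> has room for
        \<open>Y'\<close>.\<close>
      have "{w, e Y'} \<subseteq> Y'" "w \<noteq> e Y'" using Y' e[OF Y'(1)] nw by auto
      hence "2 \<le> card Y'"
        using card_mono[of Y' "{w, e Y'}"] sub(1)[of Y'] Y'(1) finite_subset[of Y' "{1..n}"]
        by (metis DiffD1 card_2_iff finite_atLeastAtMost)
      hence "card {Y'} \<le> r - 1" using sub(2)[of Y'] Y'(1) by simp
      moreover have "{Y'} \<subseteq> ?U" "r - 1 \<le> card ?U" "finite ?U" using Y' cU fin by auto
      ultimately obtain J where "{Y'} \<subseteq> J" "J \<subseteq> ?U" "card J = r - 1"
        using exists_subset_between[of "{Y'}" "r - 1" ?U] by metis
      thus ?thesis using only by blast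
    next
      case False
      obtain J where "J \<subseteq> ?U" "card J = r - 1"
        using obtain_subset_with_card_n[of "r - 1" ?U] cU by (metis le_add1 le_diff_conv le_trans)
      thus ?thesis using False by blast
    qed
    then obtain J where J: "J \<subseteq> ?U" "card J = r - 1" "\<And>Y'. Y' \<in> ?U \<Longrightarrow> w \<in> Y' \<Longrightarrow> Y' \<in> J"
      by blast
    let ?Z = "insert w (e ` J)"
    have finJ: "finite J" using J(1) fin by (rule finite_subset[OF _ finite_Diff])
    have "card (e ` J) = r - 1" using J inj by (simp add: card_image inj_on_subset)
    moreover have "w \<notin> e ` J" using nw J by blast
    ultimately have "card ?Z = r" using finJ r by simp
    moreover have "e ` J \<subseteq> {1..n} - Y" using e sub(1) J(1) by blast
    hence "?Z \<subseteq> {1..n} - Y" using w by blast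
    ultimately have "odd (card {Y'\<in>?U. Y' \<inter> ?Z = {}})"
      by (intro even_family_odd_missed[OF T Y(1)])
    moreover have "{Y'\<in>?U. Y' \<inter> ?Z = {}} = ?U - J"
    proof (rule Collect_cong[THEN trans])
      show "Y' \<in> ?U \<and> Y' \<inter> ?Z = {} \<longleftrightarrow> Y' \<in> ?U \<and> Y' \<notin> J" for Y'
      proof (cases "Y' \<in> ?U \<and> Y' \<notin> J")
        case True
        have "e Y'' \<notin> Y'" if "Y'' \<in> J" for Y''
          using disj[of Y'' Y'] that True J(1) by blast
        moreover have "w \<notin> Y'" using True J(3) by blast
        ultimately show ?thesis using True by blast
      next
        case False
        thus ?thesis using e[of Y'] by blast
      qed
    qed blast
    moreover have "card (?U - J) = 2" using J cU r finJ by (simp add: card_Diff_subset)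
    ultimately show False by simp
  qed
  have fY: "finite Y" using sub[OF Y(1)] finite_subset by blast
  have "n - r = card ({1..n} - Y)" using sub[OF Y(1)] fY by (simp add: card_Diff_subset)
  also have "\<dots> \<le> card (e ` ?U)" using cover fin by (intro card_mono) auto
  also have "\<dots> = r + 1" using inj cU by (simp add: card_image)
  finally show "n = 2 * r + 1" using n by linarith
  have "Y1 - Y = {e Y1}"
  proof
    show "{e Y1} \<subseteq> Y1 - Y" using e[OF Y(2)] by simp
    show "Y1 - Y \<subseteq> {e Y1}"
    proof
      fix x assume x: "x \<in> Y1 - Y"
      hence "x \<in> e ` ?U" using sub[of Y1] Y cover by blast
      thus "x \<in> {e Y1}" using disj x Y(2) by blast
    qed
  qed
  thus "card (Y1 - Y) = 1" by simp
qed

text \<open>Sets of size r that pairwise meet in r - 1 points share a core or lie in one (r +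
  1)-set, and \<open>even_family_minimal_disjoint\<close> excludes the latter. As n = 2 r + 1, the
  full star over the core has r + 2 members, so \<open>T\<close> is all of it.\<close>

lemma even_family_minimal_star:
  assumes T: "even_family n r T" and card: "card T = r + 2" and n: "2 * r < n" and r: "1 \<le> r"
  obtains A where "A \<subseteq> {1..n}" "card A = r - 1" "T = (\<lambda>y. insert y A) ` ({1..n} - A)"
proof -
  have fin: "finite T" by (rule even_family_finite[OF T])
  have sub: "Y' \<subseteq> {1..n}" "card Y' = r" "finite Y'" if "Y' \<in> T" for Y'
    using T that by (auto simp: even_family_def intro: finite_subset)
  obtain Y where Y: "Y \<in> T" using card card_pos_obtain[of T] by auto
  have "card (T - {Y}) = r + 1" using card Y fin by simp
  then obtain Y1 where Y1: "Y1 \<in> T - {Y}" using card_pos_obtain[of "T - {Y}"] by auto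
  have n': "n = 2 * r + 1" by (rule even_family_minimal(1)[OF T card n r Y Y1])
  have one: "card (Ya - Yb) = 1" if "Ya \<in> T" "Yb \<in> T" "Ya \<noteq> Yb" for Ya Yb
    using even_family_minimal(2)[OF T card n r that(2)] that by blast
  have inter: "card (Ya \<inter> Yb) = r - 1" if "Ya \<in> T" "Yb \<in> T" "Ya \<noteq> Yb" for Ya Yb
    using one[OF that] sub[OF that(1)] card_Diff_subset_Int[of Ya Yb] card_mono[of Ya "Ya \<inter> Yb"]
    by auto
  define A where "A = Y \<inter> Y1"
  have cA: "card A = r - 1" unfolding A_def using inter Y Y1 by blast
  have A: "A \<subseteq> {1..n}" "finite A" using sub[OF Y] by (auto simp: A_def)
  obtain y where y: "Y - Y1 = {y}" using one[OF Y] Y1 by (auto simp: card_1_singleton_iff)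
  have core: "A \<subseteq> Y2" if Y2: "Y2 \<in> T" for Y2
  proof (cases "Y2 = Y \<or> Y2 = Y1")
    case False
    hence Y2': "Y2 \<in> T - {Y}" using Y2 by blast
    obtain c where c: "Y2 - Y = {c}" using one[OF Y2 Y] False by (auto simp: card_1_singleton_iff)
    \<comment> \<open>The single point \<open>c\<close> of \<open>Y2\<close> outside
      \<open>Y\<close> is also its single point outside \<open>Y1\<close>. Hence \<open>Y2\<close>
      avoids \<open>y\<close>, and its r - 1 points in \<open>Y\<close> are those of
      \<open>A\<close>.\<close>
    have "Y2 \<inter> Y1 \<subseteq> Y"
      using even_family_minimal_disjoint[OF T card _ Y Y2' Y1] False n by auto
    hence "c \<in> Y2 - Y1" using c by blast
    moreover obtain d where "Y2 - Y1 = {d}" using one[OF Y2, of Y1] Y1 False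
      by (auto simp: card_1_singleton_iff)
    ultimately have "Y2 - Y1 = {c}" by auto
    hence "y \<notin> Y2" using y c by blast
    hence "Y2 \<inter> Y \<subseteq> A" using y by (auto simp: A_def)
    moreover have "card (Y2 \<inter> Y) = card A" using inter[OF Y2 Y] cA False by simp
    ultimately have "Y2 \<inter> Y = A" using A by (simp add: card_subset_eq)
    thus ?thesis by blast
  qed (auto simp: A_def)
  have "T \<subseteq> (\<lambda>y. insert y A) ` ({1..n} - A)"
  proof
    fix Y2 assume Y2: "Y2 \<in> T"
    have "card (Y2 - A) = 1" using core[OF Y2] sub[OF Y2] A cA r by (simp add: card_Diff_subset)
    then obtain z where "Y2 - A = {z}" by (auto simp: card_1_singleton_iff)
    hence "Y2 = insert z A" "z \<in> {1..n} - A" using core[OF Y2] sub[OF Y2] by blast+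
    thus "Y2 \<in> (\<lambda>y. insert y A) ` ({1..n} - A)" by blast
  qed
  moreover have "card ((\<lambda>y. insert y A) ` ({1..n} - A)) = r + 2"
  proof -
    have "inj_on (\<lambda>y. insert y A) ({1..n} - A)" by (auto simp: inj_on_def)
    thus ?thesis using A cA n' r by (simp add: card_image card_Diff_subset)
  qed
  ultimately have "T = (\<lambda>y. insert y A) ` ({1..n} - A)"
    using card by (intro card_subset_eq) auto
  thus ?thesis using that A cA by blast
qed

text \<open>
  For fixed \<open>x \<in> A\<close> and \<open>b \<notin> A\<close>, the core contained in \<open>A - {x} \<union> {b, c}\<close> omits a further
  element \<open>g c \<in> A - {x}\<close>; the map \<open>g\<close> is injective on \<open>r + 1\<close> values of \<open>c\<close> but has only
  \<open>r - 2\<close> possible values.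
\<close>

lemma no_partition_into_stars:
  fixes a :: "nat set \<Rightarrow> 'c"
  assumes r: "2 \<le> r" and n: "n = 2 * r + 1"
    and star: "\<And>Y. Y \<subseteq> {1..n} \<Longrightarrow> card Y = r \<Longrightarrow> \<exists>A. A \<subseteq> {1..n} \<and> card A = r - 1 \<and>
      {Y'. Y' \<subseteq> {1..n} \<and> card Y' = r \<and> a Y' = a Y} = (\<lambda>y. insert y A) ` ({1..n} - A)"
  shows False
proof -
  define cls where "cls Y = {Y'. Y' \<subseteq> {1..n} \<and> card Y' = r \<and> a Y' = a Y}" for Y
  \<comment> \<open>By \<open>ex\<close> and \<open>uniq\<close> every r-set contains exactly one
    core, so the complements of the cores form a Steiner system S(r + 1, r + 2, 2 r + 1).\<close>
  define core where "core A \<longleftrightarrow> A \<subseteq> {1..n} \<and> card A = r - 1 \<and>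
    (\<exists>Y. cls Y = (\<lambda>y. insert y A) ` ({1..n} - A))" for A
  have ex: "\<exists>A. core A \<and> A \<subseteq> Y" if Y: "Y \<subseteq> {1..n}" "card Y = r" for Y
  proof -
    obtain A where A: "A \<subseteq> {1..n}" "card A = r - 1" "cls Y = (\<lambda>y. insert y A) ` ({1..n} - A)"
      using star[OF Y] by (auto simp: cls_def)
    have "Y \<in> cls Y" using Y by (simp add: cls_def)
    hence "A \<subseteq> Y" using A by auto
    thus ?thesis using A by (auto simp: core_def)
  qed
  have uniq: "A1 = A2" if A: "core A1" "core A2" "A1 \<subseteq> Y" "A2 \<subseteq> Y"
    and Y: "Y \<subseteq> {1..n}" "card Y = r" for A1 A2 Y
  proof -
    have cls_eq: "cls Y = (\<lambda>y. insert y A) ` ({1..n} - A)" if A: "core A" "A \<subseteq> Y" for A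
    proof -
      obtain Y' where Y': "cls Y' = (\<lambda>y. insert y A) ` ({1..n} - A)" using A by (auto simp: core_def)
      have "finite Y" using Y finite_subset by blast
      hence "card (Y - A) = 1" using A Y r by (simp add: core_def card_Diff_subset finite_subset)
      then obtain y where "Y - A = {y}" by (auto simp: card_1_singleton_iff)
      hence "Y = insert y A" "y \<in> {1..n} - A" using A Y by blast+
      hence "Y \<in> cls Y'" using Y' by blast
      hence "cls Y = cls Y'" by (auto simp: cls_def)
      thus ?thesis using Y' by simp
    qed
    \<comment> \<open>A point \<open>z\<close> outside \<open>Y\<close> separates two cores:
      \<open>insert z A2\<close> lies in the class of \<open>Y\<close>, which is also the star over
      \<open>A1\<close>, and so it contains \<open>A1\<close>.\<close>
    have "card Y < card {1..n}" using Y n r by simp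
    then obtain z where z: "z \<in> {1..n}" "z \<notin> Y" using Y by (metis card_mono finite_subset finite_atLeastAtMost not_less subsetI)
    hence "insert z A2 \<in> cls Y" using cls_eq[OF A(2,4)] A by blast
    hence "insert z A2 \<in> (\<lambda>y. insert y A1) ` ({1..n} - A1)" using cls_eq[OF A(1,3)] by simp
    hence "A1 \<subseteq> insert z A2" by auto
    hence "A1 \<subseteq> A2" using A z by blast
    moreover have "finite A2" "card A1 = card A2"
      using A by (auto simp: core_def intro: finite_subset)
    ultimately show ?thesis by (simp add: card_subset_eq)
  qed
  have "card {1..r} = r" "{1..r} \<subseteq> {1..n}" using n by auto
  then obtain A where A: "core A" using ex by blast
  have A': "A \<subseteq> {1..n}" "card A = r - 1" "finite A"
    using A by (auto simp: core_def intro: finite_subset)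
  then obtain x where x: "x \<in> A" using r card_pos_obtain[of A] by auto
  let ?B = "{1..n} - A"
  have cB: "card ?B = r + 2" using A' n r by (simp add: card_Diff_subset)
  then obtain b where b: "b \<in> ?B" using card_pos_obtain[of ?B] by auto
  have "\<exists>x'. x' \<in> A - {x} \<and> core (insert b (insert c (A - {x, x'})))" if c: "c \<in> ?B - {b}" for c
  proof -
    let ?Y = "insert b (insert c (A - {x}))"
    have Y: "?Y \<subseteq> {1..n}" "card ?Y = r" using b c A' x r by auto
    obtain A1 where A1: "core A1" "A1 \<subseteq> ?Y" using ex[OF Y] by blast
    have "finite ?Y" using A' by simp
    hence "card (?Y - A1) = 1"
      using A1 Y r by (simp add: core_def card_Diff_subset finite_subset)
    then obtain x' where x': "?Y - A1 = {x'}" by (auto simp: card_1_singleton_iff)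
    hence A1': "A1 = ?Y - {x'}" "x' \<in> ?Y" using A1 by blast+
    have "card (insert z A) = r \<and> insert z A \<subseteq> {1..n}" if "z \<in> ?B" for z
      using that A' r by simp
    hence sub: "A1 = A" if "A1 \<subseteq> insert z A" "z \<in> ?B" for z
      using uniq[OF A1(1) A that(1)] that(2) by blast
    \<comment> \<open>If \<open>x'\<close> were \<open>b\<close> or \<open>c\<close>, the core
      \<open>A1\<close> would lie in one r-set together with \<open>A\<close> and thus equal it, yet
      \<open>A1\<close> misses \<open>x\<close>.\<close>
    have "x' \<noteq> b" using sub[of c] A1' c x by blast
    moreover have "x' \<noteq> c" using sub[of b] A1' b x by blast
    ultimately have "x' \<in> A - {x}" "A1 = insert b (insert c (A - {x, x'}))"
      using A1' b c by auto
    thus ?thesis using A1 by blast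
  qed
  then obtain g where g: "\<And>c. c \<in> ?B - {b} \<Longrightarrow>
      g c \<in> A - {x} \<and> core (insert b (insert c (A - {x, g c})))"
    by metis
  have "inj_on g (?B - {b})"
  proof (rule inj_onI, rule ccontr)
    \<comment> \<open>Equal values of \<open>g\<close> put two cores into the r-set
      \<open>?Y\<close>, where \<open>uniq\<close> identifies them although \<open>c\<close> and
      \<open>c'\<close> differ.\<close>
    fix c c' assume c: "c \<in> ?B - {b}" "c' \<in> ?B - {b}" "g c = g c'" "c \<noteq> c'"
    let ?A = "A - {x, g c}"
    let ?Y = "insert b (insert c (insert c' ?A))"
    have gc: "g c \<in> A" "g c \<noteq> x" using g[OF c(1)] by auto
    hence "card {x, g c} \<le> card A" using x A' by (intro card_mono) auto
    moreover have "card ?A = card A - card {x, g c}"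
      using gc x A' by (intro card_Diff_subset) auto
    ultimately have "card ?A = r - 3" "3 \<le> r" using gc A' by auto
    hence "card ?Y = r" using b c A' by auto
    moreover have "?Y \<subseteq> {1..n}" using b c A' by auto
    ultimately have "insert b (insert c ?A) = insert b (insert c' ?A)"
      using uniq[of "insert b (insert c ?A)" "insert b (insert c' ?A)" ?Y] g[OF c(1)] g[OF c(2)] c(3)
      by auto
    thus False using b c by blast
  qed
  hence "card (?B - {b}) \<le> card (A - {x})"
    by (rule card_inj_on_le) (use g A' in blast)+
  thus False using cB b A' x by simp
qed

text \<open>Every colour class has at least r + 2 members, which gives the bound with \<le>.
  Equality would make all classes stars with n = 2 r + 1; for r \<ge> 2 there is no such partition,
  and r = 1 is the pair (3, 1).\<close>

lemma even_coloring_few_colors: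
  fixes a :: "nat set \<Rightarrow> 'c" and n r :: nat
  defines "R \<equiv> {Y. Y \<subseteq> {1..n} \<and> card Y = r}"
  assumes n: "2 * r < n" and r: "1 \<le> r" and nr: "(n, r) \<noteq> (3, 1)"
    and even: "\<And>i. even_family n r {Y\<in>R. a Y = i}"
  shows "card (a ` R) * (r + 2) < card R"
proof -
  have fin: "finite R" unfolding R_def by (rule finite_subset[of _ "Pow {1..n}"]) auto
  have ge: "r + 2 \<le> card {Y\<in>R. a Y = i}" if "i \<in> a ` R" for i
    using that n by (intro even_family_card_ge[OF even]) auto
  have sum: "card R = (\<Sum>i\<in>a ` R. card {Y\<in>R. a Y = i})"
    using sum.image_gen[OF fin, of "\<lambda>_. 1::nat" a] by simp
  have "(\<Sum>i\<in>a ` R. r + 2) \<le> (\<Sum>i\<in>a ` R. card {Y\<in>R. a Y = i})"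
    by (intro sum_mono ge)
  moreover have "(\<Sum>i\<in>a ` R. r + 2) \<noteq> (\<Sum>i\<in>a ` R. card {Y\<in>R. a Y = i})"
  proof
    assume eq: "(\<Sum>i\<in>a ` R. r + 2) = (\<Sum>i\<in>a ` R. card {Y\<in>R. a Y = i})"
    have all: "card {Y\<in>R. a Y = i} = r + 2" if "i \<in> a ` R" for i
    proof (rule ccontr)
      assume "card {Y\<in>R. a Y = i} \<noteq> r + 2"
      hence "r + 2 < card {Y\<in>R. a Y = i}" using ge[OF that] by simp
      hence "(\<Sum>i\<in>a ` R. r + 2) < (\<Sum>i\<in>a ` R. card {Y\<in>R. a Y = i})"
        using fin that ge by (intro sum_strict_mono_ex1) auto
      thus False using eq by simp
    qed
    have star: "\<exists>A. A \<subseteq> {1..n} \<and> card A = r - 1 \<and>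
      {Y'. Y' \<subseteq> {1..n} \<and> card Y' = r \<and> a Y' = a Y} = (\<lambda>y. insert y A) ` ({1..n} - A)"
      if "Y \<subseteq> {1..n}" "card Y = r" for Y
    proof -
      have "a Y \<in> a ` R" using that by (simp add: R_def)
      from even_family_minimal_star[OF even all[OF this] n r] obtain A where
        A: "A \<subseteq> {1..n}" "card A = r - 1"
          "{Y'\<in>R. a Y' = a Y} = (\<lambda>y. insert y A) ` ({1..n} - A)" by metis
      have "{Y'\<in>R. a Y' = a Y} = {Y'. Y' \<subseteq> {1..n} \<and> card Y' = r \<and> a Y' = a Y}"
        unfolding R_def by blast
      with A show ?thesis by metis
    qed
    have "card {1..r} = r" "{1..r} \<subseteq> {1..n}" using n by auto
    hence Y0: "{1..r} \<in> R" by (simp add: R_def)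
    let ?T = "{Y\<in>R. a Y = a {1..r}}"
    have cT: "card ?T = r + 2" using all Y0 by blast
    have "card (?T - {{1..r}}) = r + 1" using cT Y0 fin by simp
    then obtain Y1 where Y1: "Y1 \<in> ?T - {{1..r}}" using card_pos_obtain[of "?T - {{1..r}}"] by auto
    have n': "n = 2 * r + 1"
      using even_family_minimal(1)[OF even cT n r _ Y1] Y0 by simp
    hence "2 \<le> r" using nr r by (cases "r = 1") auto
    thus False using no_partition_into_stars[of r n a] n' star by blast
  qed
  ultimately show ?thesis using sum by simp
qed

section \<open>Densities of kernels with finitely many values\<close>

lemma prob_space_unit_interval: "prob_space unit_interval"
  unfolding unit_interval_def by (rule prob_space_restrict_space) auto

lemma space_unit_interval [simp]: "space unit_interval = {0..1}"
  by (simp add: unit_interval_def space_restrict_space)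

text \<open>Lebesgue measure on the unit interval is the source of a uniform random element of
  \<open>S\<close>; in this way finite matrices become step kernels.\<close>

definition uniform_map :: "(real \<Rightarrow> 'c) \<Rightarrow> 'c set \<Rightarrow> bool" where
  "uniform_map p S \<longleftrightarrow> finite S \<and> (\<forall>x. p x \<in> S) \<and>
    (\<forall>c\<in>S. {x\<in>{0..1}. p x = c} \<in> sets unit_interval \<and>
      emeasure unit_interval {x\<in>{0..1}. p x = c} = ennreal (1 / card S))"

lemma uniform_map_exists:
  assumes "finite S" "S \<noteq> {}"
  obtains p where "uniform_map p S"
proof -
  define N where "N = card S"
  have N: "0 < N" using assms by (simp add: N_def card_gt_0_iff)
  obtain h where h: "bij_betw h {0..<N} S"
    using ex_bij_betw_nat_finite[OF assms(1)] by (auto simp: N_def)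
  \<comment> \<open>The interval is cut into \<open>N\<close> half-open cells of length 1 / N. The
    endpoint 1 gets index 0, which enlarges the first cell by a null set only.\<close>
  define idx :: "real \<Rightarrow> nat" where "idx x = (if 0 \<le> x \<and> x < 1 then nat \<lfloor>real N * x\<rfloor> else 0)" for x
  have idx: "idx x < N" for x
  proof (cases "0 \<le> x \<and> x < 1")
    case True
    hence "N * x < N" using N by simp
    hence "\<lfloor>N * x\<rfloor> < int N" by (simp add: floor_less_iff)
    thus ?thesis using True N by (simp add: idx_def nat_less_iff)
  qed (use N in \<open>auto simp: idx_def\<close>)
  have "uniform_map (h \<circ> idx) S"
    unfolding uniform_map_def
  proof (intro conjI allI ballI)
    show "finite S" by fact
    show "(h \<circ> idx) x \<in> S" for x using h idx by (auto simp: bij_betw_def)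
    fix c assume "c \<in> S"
    then obtain i where i: "i < N" "c = h i" using h by (auto simp: bij_betw_def)
    let ?F = "{x \<in> {0..1}. (h \<circ> idx) x = c}"
    let ?I = "{real i / N..<real (Suc i) / N}"
    have eq: "(h \<circ> idx) x = c \<longleftrightarrow> idx x = i" for x
      using h i idx[of x] by (auto simp: bij_betw_def dest: inj_onD)
    have I: "x \<in> ?I \<longleftrightarrow> idx x = i" if "0 \<le> x" "x < 1" for x
    proof -
      have "idx x = i \<longleftrightarrow> \<lfloor>N * x\<rfloor> = int i"
        using that by (auto simp: idx_def nat_eq_iff2)
      also have "\<dots> \<longleftrightarrow> real i \<le> N * x \<and> N * x < real i + 1"
        by (simp add: floor_eq_iff)
      also have "\<dots> \<longleftrightarrow> x \<in> ?I" using N by (auto simp: field_simps)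
      finally show ?thesis by simp
    qed
    have "real (Suc i) \<le> N" using i by linarith
    hence "real (Suc i) / N \<le> 1" using N by simp
    hence I1: "0 \<le> x \<and> x < 1" if "x \<in> ?I" for x
      using that order_trans[of 0 "real i / N" x] by auto
    have F: "?F = ?I \<union> (if i = 0 then {1} else {})"
    proof (rule set_eqI)
      fix x :: real
      consider "0 \<le> x \<and> x < 1" | "x = 1" | "\<not> (0 \<le> x \<and> x \<le> 1)" by linarith
      thus "x \<in> ?F \<longleftrightarrow> x \<in> ?I \<union> (if i = 0 then {1} else {})"
      proof cases
        case 1 thus ?thesis using I[of x] eq[of x] by auto
      next
        case 2
        hence "x \<notin> ?I" using I1 by blast
        thus ?thesis using 2 eq[of x] by (auto simp: idx_def)
      next
        case 3
        hence "x \<notin> ?I" using I1[of x] by auto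
        thus ?thesis using 3 by auto
      qed
    qed
    have meas: "?F \<in> sets lborel" unfolding F by simp
    have sub: "?F \<subseteq> {0..1}" by blast
    show sets: "?F \<in> sets unit_interval"
      using meas sub by (auto simp: unit_interval_def sets_restrict_space_iff)
    have "emeasure unit_interval ?F = emeasure lborel ?F"
      unfolding unit_interval_def by (rule emeasure_restrict_space) (use sub in auto)
    also have "\<dots> = emeasure lborel ?I"
      unfolding F by (rule emeasure_Un_null_set) (auto simp: null_sets_def)
    also have "\<dots> = ennreal (1 / N)"
    proof -
      have "real i / N \<le> real (Suc i) / N" using N by (intro divide_right_mono) auto
      moreover have "real (Suc i) / N - real i / N = 1 / N" by (simp add: diff_divide_distrib[symmetric])
      ultimately show ?thesis by simp
    qed
    finally show "emeasure unit_interval ?F = ennreal (1 / card S)" by (simp add: N_def)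
  qed
  thus ?thesis using that by blast
qed

lemma uniform_map_PiM:
  assumes p: "uniform_map p S" and L: "finite L" and a: "a \<in> L \<rightarrow>\<^sub>E S"
  defines "A \<equiv> {x\<in>space (\<Pi>\<^sub>M u\<in>L. unit_interval). \<forall>u\<in>L. p (x u) = a u}"
  shows "A \<in> sets (\<Pi>\<^sub>M u\<in>L. unit_interval)"
    and "emeasure (\<Pi>\<^sub>M u\<in>L. unit_interval) A = ennreal ((1 / card S) ^ card L)"
proof -
  interpret U: prob_space unit_interval by (rule prob_space_unit_interval)
  interpret product_sigma_finite "\<lambda>_. unit_interval" ..
  have A: "A = (\<Pi>\<^sub>E u\<in>L. {x\<in>{0..1}. p x = a u})"
    unfolding A_def by (auto simp: space_PiM PiE_iff extensional_def)
  have fib: "{x\<in>{0..1}. p x = a u} \<in> sets unit_interval"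
    "emeasure unit_interval {x\<in>{0..1}. p x = a u} = ennreal (1 / card S)" if "u \<in> L" for u
    using p a that unfolding uniform_map_def by (auto simp: PiE_iff)
  show "A \<in> sets (\<Pi>\<^sub>M u\<in>L. unit_interval)"
    unfolding A using L fib by (intro sets_PiM_I_finite) auto
  have "emeasure (\<Pi>\<^sub>M u\<in>L. unit_interval) A = (\<Prod>u\<in>L. ennreal (1 / card S))"
    unfolding A using L fib by (subst emeasure_PiM) (auto intro!: prod.cong)
  also have "\<dots> = ennreal ((1 / card S) ^ card L)" by (simp add: ennreal_power)
  finally show "emeasure (\<Pi>\<^sub>M u\<in>L. unit_interval) A = ennreal ((1 / card S) ^ card L)" .
qed

text \<open>The integrand is constant on the boxes \<open>A a \<times> B b\<close>, which all have
  the same measure, so the integral is an average over pairs of discrete assignments.\<close>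

lemma hom_density_uniform_map:
  fixes H :: "'a bigraph" and K :: "'c \<Rightarrow> 'd \<Rightarrow> real"
  defines "L \<equiv> left_part H" and "R \<equiv> right_part H"
  assumes fin: "finite L" "finite R" and E: "edges H \<subseteq> L \<times> R"
    and p: "uniform_map p S" and p': "uniform_map p' S'"
  shows "hom_density H (\<lambda>(x, y). K (p x) (p' y)) =
    (\<Sum>a\<in>L \<rightarrow>\<^sub>E S. \<Sum>b\<in>R \<rightarrow>\<^sub>E S'. \<Prod>(u, v)\<in>edges H. K (a u) (b v)) / (card S ^ card L * card S' ^ card R)"
proof -
  let ?P = "\<Pi>\<^sub>M u\<in>L. unit_interval" and ?Q = "\<Pi>\<^sub>M v\<in>R. unit_interval"
  define A where "A a = {x\<in>space ?P. \<forall>u\<in>L. p (x u) = a u}" for a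
  define B where "B b = {y\<in>space ?Q. \<forall>v\<in>R. p' (y v) = b v}" for b
  define F where "F a b = (\<Prod>(u, v)\<in>edges H. K (a u) (b v))" for a b
  interpret U: prob_space unit_interval by (rule prob_space_unit_interval)
  interpret P: prob_space ?P by (intro prob_space_PiM prob_space_unit_interval)
  interpret Q: prob_space ?Q by (intro prob_space_PiM prob_space_unit_interval)
  interpret PQ: pair_prob_space ?P ?Q ..
  have finS: "finite S" "finite S'" using p p' by (auto simp: uniform_map_def)
  hence finE: "finite (L \<rightarrow>\<^sub>E S)" "finite (R \<rightarrow>\<^sub>E S')" using fin by (auto intro: finite_PiE)
  have A: "A a \<in> sets ?P" "emeasure ?P (A a) = ennreal ((1 / card S) ^ card L)" if "a \<in> L \<rightarrow>\<^sub>E S" for a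
    unfolding A_def using uniform_map_PiM[OF p fin(1) that] by auto
  have B: "B b \<in> sets ?Q" "emeasure ?Q (B b) = ennreal ((1 / card S') ^ card R)" if "b \<in> R \<rightarrow>\<^sub>E S'" for b
    unfolding B_def using uniform_map_PiM[OF p' fin(2) that] by auto
  have AB: "A a \<times> B b \<in> sets (?P \<Otimes>\<^sub>M ?Q)"
    "measure (?P \<Otimes>\<^sub>M ?Q) (A a \<times> B b) = (1 / card S) ^ card L * (1 / card S') ^ card R"
    if "a \<in> L \<rightarrow>\<^sub>E S" "b \<in> R \<rightarrow>\<^sub>E S'" for a b
    using A[OF that(1)] B[OF that(2)]
    by (auto simp: measure_def Q.emeasure_pair_measure_Times ennreal_mult[symmetric])
  have "hom_density H (\<lambda>(x, y). K (p x) (p' y)) =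
    (\<integral>z. (\<Sum>a\<in>L \<rightarrow>\<^sub>E S. \<Sum>b\<in>R \<rightarrow>\<^sub>E S'. F a b * indicator (A a \<times> B b) z) \<partial>(?P \<Otimes>\<^sub>M ?Q))"
    unfolding hom_density_def L_def[symmetric] R_def[symmetric]
  proof (intro Bochner_Integration.integral_cong refl)
    fix z assume "z \<in> space (?P \<Otimes>\<^sub>M ?Q)"
    then obtain x y where z: "z = (x, y)" "x \<in> space ?P" "y \<in> space ?Q"
      by (auto simp: space_pair_measure)
    define a0 where "a0 = restrict (\<lambda>u. p (x u)) L"
    define b0 where "b0 = restrict (\<lambda>v. p' (y v)) R"
    have a0: "a0 \<in> L \<rightarrow>\<^sub>E S" and b0: "b0 \<in> R \<rightarrow>\<^sub>E S'"
      using p p' by (auto simp: a0_def b0_def uniform_map_def)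
    have xA: "x \<in> A a \<longleftrightarrow> a = a0" if "a \<in> L \<rightarrow>\<^sub>E S" for a
      using that z by (auto simp: A_def a0_def PiE_iff extensional_def fun_eq_iff)
    have yB: "y \<in> B b \<longleftrightarrow> b = b0" if "b \<in> R \<rightarrow>\<^sub>E S'" for b
      using that z by (auto simp: B_def b0_def PiE_iff extensional_def fun_eq_iff)
    have "(\<Sum>a\<in>L \<rightarrow>\<^sub>E S. \<Sum>b\<in>R \<rightarrow>\<^sub>E S'. F a b * indicator (A a \<times> B b) z)
        = (\<Sum>a\<in>L \<rightarrow>\<^sub>E S. \<Sum>b\<in>R \<rightarrow>\<^sub>E S'. if b = b0 then (if a = a0 then F a b else 0) else 0)"
      by (intro sum.cong refl) (auto simp: z xA yB indicator_def)
    also have "\<dots> = F a0 b0" using finE a0 b0 by (simp add: sum.delta)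
    also have "\<dots> = (\<Prod>(u, v)\<in>edges H. K (p (x u)) (p' (y v)))"
      unfolding F_def using E by (intro prod.cong) (auto simp: a0_def b0_def)
    finally show "(case z of (x, y) \<Rightarrow> \<Prod>(u, v)\<in>edges H. case (x u, y v) of (x, y) \<Rightarrow> K (p x) (p' y)) =
      (\<Sum>a\<in>L \<rightarrow>\<^sub>E S. \<Sum>b\<in>R \<rightarrow>\<^sub>E S'. F a b * indicator (A a \<times> B b) z)"
      by (simp add: z case_prod_beta)
  qed
  also have "\<dots> = (\<Sum>a\<in>L \<rightarrow>\<^sub>E S. \<Sum>b\<in>R \<rightarrow>\<^sub>E S'. F a b * measure (?P \<Otimes>\<^sub>M ?Q) (A a \<times> B b))"
  proof -
    have int: "integrable (?P \<Otimes>\<^sub>M ?Q) (\<lambda>z. F a b * indicator (A a \<times> B b) z)"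
      if "a \<in> L \<rightarrow>\<^sub>E S" "b \<in> R \<rightarrow>\<^sub>E S'" for a b
      using AB(1)[OF that] by (intro integrable_mult_right integrable_real_indicator)
        (auto simp: PQ.emeasure_eq_measure)
    have "(\<integral>z. (\<Sum>a\<in>L \<rightarrow>\<^sub>E S. \<Sum>b\<in>R \<rightarrow>\<^sub>E S'. F a b * indicator (A a \<times> B b) z) \<partial>(?P \<Otimes>\<^sub>M ?Q))
      = (\<Sum>a\<in>L \<rightarrow>\<^sub>E S. \<integral>z. (\<Sum>b\<in>R \<rightarrow>\<^sub>E S'. F a b * indicator (A a \<times> B b) z) \<partial>(?P \<Otimes>\<^sub>M ?Q))"
      by (intro Bochner_Integration.integral_sum Bochner_Integration.integrable_sum int)
    also have "\<dots> = (\<Sum>a\<in>L \<rightarrow>\<^sub>E S. \<Sum>b\<in>R \<rightarrow>\<^sub>E S'. \<integral>z. F a b * indicator (A a \<times> B b) z \<partial>(?P \<Otimes>\<^sub>M ?Q))"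
      by (intro sum.cong refl Bochner_Integration.integral_sum int)
    also have "\<dots> = (\<Sum>a\<in>L \<rightarrow>\<^sub>E S. \<Sum>b\<in>R \<rightarrow>\<^sub>E S'. F a b * measure (?P \<Otimes>\<^sub>M ?Q) (A a \<times> B b))"
      using AB(1) by (intro sum.cong refl) (simp add: sets.Int_space_eq2)
    finally show ?thesis .
  qed
  also have "\<dots> = (\<Sum>a\<in>L \<rightarrow>\<^sub>E S. \<Sum>b\<in>R \<rightarrow>\<^sub>E S'. F a b) * ((1 / card S) ^ card L * (1 / card S') ^ card R)"
    using AB(2) by (simp add: sum_distrib_right)
  finally show ?thesis by (simp add: F_def power_one_over divide_inverse power_inverse)
qed

lemma uniform_map_kernel:
  assumes p: "uniform_map p S" and p': "uniform_map p' S'"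
  shows "(\<lambda>(x, y). K (p x) (p' y)) \<in> kernels"
proof -
  let ?A = "\<lambda>c. {x\<in>{0..1}. p x = c}" and ?B = "\<lambda>c. {x\<in>{0..1}. p' x = c}"
  have fin: "finite S" "finite S'" using p p' by (auto simp: uniform_map_def)
  have "(\<lambda>z. \<Sum>c\<in>S. \<Sum>d\<in>S'. K c d * indicator (?A c \<times> ?B d) z) \<in> borel_measurable unit_square"
    using p p' by (intro borel_measurable_sum borel_measurable_times borel_measurable_const
        borel_measurable_indicator pair_measureI) (auto simp: uniform_map_def)
  moreover have "(\<Sum>c\<in>S. \<Sum>d\<in>S'. K c d * indicator (?A c \<times> ?B d) z) = (case z of (x, y) \<Rightarrow> K (p x) (p' y))"
    if "z \<in> space unit_square" for z
  proof -
    obtain x y where xy: "z = (x, y)" by (cases z)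
    hence z: "z = (x, y)" "x \<in> {0..1}" "y \<in> {0..1}" using that by (auto simp: space_pair_measure)
    have "(\<Sum>c\<in>S. \<Sum>d\<in>S'. K c d * indicator (?A c \<times> ?B d) z) =
      (\<Sum>c\<in>S. \<Sum>d\<in>S'. if d = p' y then (if c = p x then K c d else 0) else 0)"
      using z by (intro sum.cong refl) (auto simp: indicator_def)
    also have "\<dots> = K (p x) (p' y)" using p p' fin by (simp add: uniform_map_def)
    finally show ?thesis by (simp add: z)
  qed
  ultimately have "(\<lambda>(x, y). K (p x) (p' y)) \<in> borel_measurable unit_square"
    by (subst (asm) measurable_cong) auto
  moreover have "(\<lambda>(x, y). K (p x) (p' y)) ` ({0..1} \<times> {0..1}) \<subseteq> (\<lambda>(c, d). K c d) ` (S \<times> S')"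
    using p p' by (auto simp: uniform_map_def)
  hence "bounded ((\<lambda>(x, y). K (p x) (p' y)) ` ({0..1} \<times> {0..1}))"
    using fin by (meson bounded_subset finite_SigmaI finite_imageI finite_imp_bounded)
  ultimately show ?thesis by (simp add: kernels_def)
qed

section \<open>Colour kernels\<close>

definition moment4 :: "(nat \<Rightarrow> real) \<Rightarrow> nat \<Rightarrow> real" where
  "moment4 \<phi> N = (\<Sum>s<4. \<phi> s ^ N) / 4"

definition color_count :: "'a bigraph \<Rightarrow> ('a \<Rightarrow> nat) \<Rightarrow> 'a \<Rightarrow> nat \<Rightarrow> nat" where
  "color_count H b u i = card {v\<in>right_part H. (u, v) \<in> edges H \<and> b v = i}"

text \<open>With the colouring \<open>b\<close> of the right part fixed, the values
  \<open>a u i\<close> are independent over all \<open>u\<close> and \<open>i\<close>, so averaging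
  over \<open>a\<close> splits into one moment for each left vertex and colour.\<close>

lemma hom_density_color_kernel:
  fixes H :: "'a bigraph" and \<phi> :: "nat \<Rightarrow> real"
  defines "L \<equiv> left_part H" and "R \<equiv> right_part H"
  assumes fin: "finite L" "finite R" and E: "edges H \<subseteq> L \<times> R"
    and p: "uniform_map p ({..<q} \<rightarrow>\<^sub>E {..<4})" and p': "uniform_map p' {..<q}"
  shows "hom_density H (\<lambda>(x, y). \<phi> (p x (p' y))) =
    (\<Sum>b\<in>R \<rightarrow>\<^sub>E {..<q}. \<Prod>u\<in>L. \<Prod>i<q. moment4 \<phi> (color_count H b u i)) / q ^ card R"
proof -
  let ?S = "{..<q} \<rightarrow>\<^sub>E {..<4::nat}"
  have finE: "finite (edges H)" using E fin by (meson finite_SigmaI finite_subset)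
  have cS: "card ?S = 4 ^ q" by (simp add: card_PiE)
  \<comment> \<open>The edges are grouped by their left end and then by the colour of their right
    end.\<close>
  have split: "(\<Prod>(u, v)\<in>edges H. \<phi> (a u (b v))) = (\<Prod>u\<in>L. \<Prod>i<q. \<phi> (a u i) ^ color_count H b u i)"
    if b: "b \<in> R \<rightarrow>\<^sub>E {..<q}" for a b
  proof -
    have eq: "edges H = (SIGMA u:L. {v\<in>R. (u, v) \<in> edges H})" using E by auto
    have "(\<Prod>(u, v)\<in>edges H. \<phi> (a u (b v))) = (\<Prod>u\<in>L. \<Prod>v\<in>{v\<in>R. (u, v) \<in> edges H}. \<phi> (a u (b v)))"
      by (subst eq, subst prod.Sigma) (use fin in auto)
    also have "\<dots> = (\<Prod>u\<in>L. \<Prod>i<q. \<phi> (a u i) ^ color_count H b u i)"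
    proof (intro prod.cong refl)
      fix u
      have "(\<Prod>v\<in>{v\<in>R. (u, v) \<in> edges H}. \<phi> (a u (b v)))
        = (\<Prod>i<q. \<Prod>v\<in>{v\<in>{v\<in>R. (u, v) \<in> edges H}. b v = i}. \<phi> (a u (b v)))"
        using b fin by (intro prod.group[symmetric]) auto
      also have "\<dots> = (\<Prod>i<q. \<phi> (a u i) ^ color_count H b u i)"
      proof (intro prod.cong refl)
        fix i
        have "{v\<in>{v\<in>R. (u, v) \<in> edges H}. b v = i} = {v\<in>R. (u, v) \<in> edges H \<and> b v = i}" by auto
        thus "(\<Prod>v\<in>{v\<in>{v\<in>R. (u, v) \<in> edges H}. b v = i}. \<phi> (a u (b v))) = \<phi> (a u i) ^ color_count H b u i"
          by (simp add: color_count_def R_def)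
      qed
      finally show "(\<Prod>v\<in>{v\<in>R. (u, v) \<in> edges H}. \<phi> (a u (b v))) = (\<Prod>i<q. \<phi> (a u i) ^ color_count H b u i)" .
    qed
    finally show ?thesis .
  qed
  have "(\<Sum>a\<in>L \<rightarrow>\<^sub>E ?S. \<Sum>b\<in>R \<rightarrow>\<^sub>E {..<q}. \<Prod>(u, v)\<in>edges H. \<phi> (a u (b v)))
    = (\<Sum>b\<in>R \<rightarrow>\<^sub>E {..<q}. \<Sum>a\<in>L \<rightarrow>\<^sub>E ?S. \<Prod>u\<in>L. \<Prod>i<q. \<phi> (a u i) ^ color_count H b u i)"
    by (subst sum.swap) (intro sum.cong refl split)
  also have "\<dots> = (\<Sum>b\<in>R \<rightarrow>\<^sub>E {..<q}. (\<Prod>u\<in>L. \<Prod>i<q. moment4 \<phi> (color_count H b u i))) * (4 ^ q) ^ card L"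
    unfolding sum_distrib_right
  proof (intro sum.cong refl)
    fix b
    have "(\<Sum>a\<in>L \<rightarrow>\<^sub>E ?S. \<Prod>u\<in>L. \<Prod>i<q. \<phi> (a u i) ^ color_count H b u i)
      = (\<Prod>u\<in>L. \<Sum>c\<in>?S. \<Prod>i<q. \<phi> (c i) ^ color_count H b u i)"
      using fin by (intro prod_sum_PiE[symmetric]) (auto intro: finite_PiE)
    also have "\<dots> = (\<Prod>u\<in>L. \<Prod>i<q. \<Sum>s<4. \<phi> s ^ color_count H b u i)"
      by (intro prod.cong refl prod_sum_PiE[symmetric]) auto
    also have "\<dots> = (\<Prod>u\<in>L. \<Prod>i<q. moment4 \<phi> (color_count H b u i) * 4)"
      by (simp add: moment4_def)
    also have "\<dots> = (\<Prod>u\<in>L. \<Prod>i<q. moment4 \<phi> (color_count H b u i)) * (4 ^ q) ^ card L"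
      by (simp add: prod.distrib)
    finally show "(\<Sum>a\<in>L \<rightarrow>\<^sub>E ?S. \<Prod>u\<in>L. \<Prod>i<q. \<phi> (a u i) ^ color_count H b u i)
      = (\<Prod>u\<in>L. \<Prod>i<q. moment4 \<phi> (color_count H b u i)) * (4 ^ q) ^ card L" .
  qed
  finally show ?thesis
    using hom_density_uniform_map[where K = "\<lambda>c d. \<phi> (c d)" and H = H, OF _ _ _ p p'] fin E
    by (simp add: L_def R_def cS)
qed

text \<open>For j = 1, 2, 3 these are the nontrivial characters of the Klein four-group on
  \<open>{0, 1, 2, 3}\<close> with identity 0; character \<open>j\<close> has kernel
  \<open>{0, j}\<close>.\<close>

definition sign4 :: "nat \<Rightarrow> nat \<Rightarrow> real" where
  "sign4 j s = (if s = 0 \<or> s = j then 1 else - 1)"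

lemma lessThan_4: "{..<4::nat} = {0, 1, 2, 3}"
  by auto

lemma moment4_sign4:
  assumes "j \<in> {1, 2, 3}"
  shows "moment4 (sign4 j) N = of_bool (even N)"
  using assms by (auto simp: moment4_def lessThan_4 sign4_def)

text \<open>The characters sum to 3 at the identity and to -1 elsewhere, which gives a closed form.
  For N = 1 the moment is exactly 1, hence the exclusion of k = 1. For N \<ge> 2 the part (1 + 3
  \<beta>) ^ N \<ge> 9 \<beta> ^ N outweighs the possibly negative 3 (1 - \<beta>) ^ N.\<close>

lemma moment4_sign4_sum_ge:
  fixes \<beta> :: real
  assumes l: "1 \<le> \<beta>" and k: "k \<le> N" "k \<noteq> 1"
  shows "\<beta> ^ k \<le> moment4 (\<lambda>s. 1 + \<beta> * (sign4 1 s + sign4 2 s + sign4 3 s)) N"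
proof -
  have m: "moment4 (\<lambda>s. 1 + \<beta> * (sign4 1 s + sign4 2 s + sign4 3 s)) N =
    ((1 + 3 * \<beta>) ^ N + 3 * (1 - \<beta>) ^ N) / 4"
    by (simp add: moment4_def lessThan_4 sign4_def algebra_simps)
  consider "N = 0" | "N = 1" | "2 \<le> N" by linarith
  thus ?thesis
  proof cases
    case 3
    have "\<bar>(1 - \<beta>) ^ N\<bar> \<le> \<beta> ^ N"
      unfolding power_abs using l by (intro power_mono) auto
    hence "- ((1 - \<beta>) ^ N) \<le> \<beta> ^ N" by linarith
    moreover have "9 * \<beta> ^ N \<le> (1 + 3 * \<beta>) ^ N"
    proof -
      have "(3::real) ^ 2 * \<beta> ^ N \<le> 3 ^ N * \<beta> ^ N"
        using 3 l by (intro mult_right_mono power_increasing) auto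
      also have "\<dots> \<le> (1 + 3 * \<beta>) ^ N"
        unfolding power_mult_distrib[symmetric] using l by (intro power_mono) auto
      finally show ?thesis by simp
    qed
    moreover have "\<beta> ^ k \<le> \<beta> ^ N" using l k by (intro power_increasing) auto
    moreover have "0 \<le> \<beta> ^ N" using l by simp
    moreover have "x \<le> (A + 3 * B) / 4"
      if "- B \<le> y" "9 * y \<le> A" "x \<le> y" "0 \<le> y" for x y A B :: real
      using that by simp
    ultimately show ?thesis unfolding m by blast
  next
    case 2
    hence "k = 0" using k by linarith
    thus ?thesis unfolding m using 2 by simp
  next
    case 1
    thus ?thesis unfolding m using k by simp
  qed
qed

text \<open>A function with at most \<open>D\<close> values factors through \<open>{..<D}\<close>,
  and the bound counts the pairs of factors \<open>e\<close> and \<open>h\<close>.\<close>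

lemma card_few_values_le:
  fixes R :: "'a set"
  assumes fin: "finite R" "R \<noteq> {}"
  shows "card {b\<in>R \<rightarrow>\<^sub>E {..<q::nat}. card (b ` R) \<le> D} \<le> q ^ D * D ^ card R"
proof -
  let ?A = "{..<D} \<rightarrow>\<^sub>E {..<q}" and ?B = "R \<rightarrow>\<^sub>E {..<D}"
  have "{b\<in>R \<rightarrow>\<^sub>E {..<q}. card (b ` R) \<le> D} \<subseteq> (\<lambda>(e, h). restrict (e \<circ> h) R) ` (?A \<times> ?B)"
  proof
    fix b assume "b \<in> {b\<in>R \<rightarrow>\<^sub>E {..<q}. card (b ` R) \<le> D}"
    hence b: "b \<in> R \<rightarrow>\<^sub>E {..<q}" "card (b ` R) \<le> D" by auto
    define c where "c = card (b ` R)"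
    obtain g where g: "bij_betw g (b ` R) {0..<c}"
      using ex_bij_betw_finite_nat[of "b ` R"] fin by (auto simp: c_def)
    obtain v0 where v0: "v0 \<in> R" using fin by blast
    define h where "h = restrict (g \<circ> b) R"
    \<comment> \<open>Indices from \<open>c\<close> on are padded with a value of \<open>b\<close>
      to keep \<open>e\<close> inside \<open>{..<q}\<close>.\<close>
    define e where "e = restrict (\<lambda>i. if i < c then inv_into (b ` R) g i else b v0) {..<D}"
    have gb: "g (b v) < c" if "v \<in> R" for v
      using bij_betwE[OF g] that by auto
    have inv: "inv_into (b ` R) g i \<in> b ` R" if "i < c" for i
      using g that by (auto simp: bij_betw_def inv_into_into)
    have "g (b v) < D" if "v \<in> R" for v using gb[OF that] b(2) by (simp add: c_def)
    hence "h \<in> ?B" by (simp add: h_def)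
    moreover have bR: "b ` R \<subseteq> {..<q}" using b(1) by auto
    have "e i < q" if "i < D" for i
      using inv[of i] bR v0 that by (cases "i < c") (auto simp: e_def)
    hence "e \<in> ?A" by (simp add: PiE_iff) (simp add: e_def)
    moreover have "restrict (e \<circ> h) R = b"
    proof (rule ext)
      fix v show "restrict (e \<circ> h) R v = b v"
      proof (cases "v \<in> R")
        case True
        have "inv_into (b ` R) g (g (b v)) = b v"
          using g True by (auto simp: bij_betw_def intro: inv_into_f_f)
        moreover have "g (b v) < D" using gb[OF True] b(2) by (simp add: c_def)
        ultimately show ?thesis using gb[OF True] True by (simp add: e_def h_def)
      next
        case False
        thus ?thesis using b by (auto simp: PiE_iff extensional_def)
      qed
    qed
    ultimately have "b = (\<lambda>(e, h). restrict (e \<circ> h) R) (e, h)" "(e, h) \<in> ?A \<times> ?B" by simp_all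
    thus "b \<in> (\<lambda>(e, h). restrict (e \<circ> h) R) ` (?A \<times> ?B)" by (rule image_eqI)
  qed
  moreover have finAB: "finite (?A \<times> ?B)" using fin by (intro finite_SigmaI finite_PiE) auto
  ultimately have "card {b\<in>R \<rightarrow>\<^sub>E {..<q}. card (b ` R) \<le> D}
      \<le> card ((\<lambda>(e, h). restrict (e \<circ> h) R) ` (?A \<times> ?B))"
    by (intro card_mono finite_imageI)
  also have "\<dots> \<le> card (?A \<times> ?B)" using finAB by (rule card_image_le)
  also have "\<dots> = q ^ D * D ^ card R" using fin by (simp add: card_cartesian_product card_PiE)
  finally show ?thesis .
qed

lemma not_AE_zero_unit_square:
  assumes "\<And>z. f z \<noteq> (0::real)"
  shows "\<not> (AE z in unit_square. f z = 0)"
proof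
  interpret U: prob_space unit_interval by (rule prob_space_unit_interval)
  interpret pair_prob_space unit_interval unit_interval ..
  assume "AE z in unit_square. f z = 0"
  hence "AE z in unit_square. False" using assms by simp
  thus False by simp
qed

lemma prod_of_bool:
  "finite A \<Longrightarrow> (\<Prod>x\<in>A. of_bool (P x)) = (of_bool (\<forall>x\<in>A. P x) :: real)"
  by (induction A rule: finite_induct) (auto simp: of_bool_def)

text \<open>
  With \<open>m = card R\<close>, \<open>t = card T\<close> and \<open>\<tau>\<close> the density of one character, the comparison below is
  \<open>q powr (1 - t) * \<tau> powr (- t / m) \<le> 4 ^ e\<close>, raised to the power \<open>m\<close> so that all exponents
  are natural numbers.
\<close>

theorem not_norming_criterion:
  fixes H :: "'a bigraph" and T :: "'a set" and d :: nat
  defines "L \<equiv> left_part H" and "R \<equiv> right_part H"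
  assumes fin: "finite L" "finite R" and E: "edges H \<subseteq> L \<times> R"
    and deg: "\<And>v. v \<in> R \<Longrightarrow> card {u\<in>L. (u, v) \<in> edges H} = d" and d: "0 < d"
    and T: "T \<subseteq> R" "T \<noteq> {}" "\<And>u. u \<in> L \<Longrightarrow> card {v\<in>T. (u, v) \<in> edges H} \<noteq> 1"
    and few: "\<And>b. (\<And>u i. u \<in> L \<Longrightarrow> even (color_count H b u i)) \<Longrightarrow> card (b ` R) * card T < card R"
  shows "\<not> norming H"
proof
  assume norm: "norming H"
  define m where "m = card R"
  define t where "t = card T"
  define e where "e = card (edges H)"
  \<comment> \<open>By \<open>few\<close>, \<open>D\<close> bounds the number of colours of an even
    colouring, and \<open>q\<close> is one more than the upper bound on \<open>q\<close> to which
    the norm axioms will lead.\<close>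
  define D where "D = (m - 1) div t"
  define q where "q = 4 ^ (e * m) * D ^ (m * t) + (1::nat)"
  have finT: "finite T" using T(1) fin(2) by (rule finite_subset)
  have t: "0 < t" "t \<le> m" using T finT fin by (auto simp: t_def m_def card_gt_0_iff card_mono)
  have R: "R \<noteq> {}" using T by blast
  have q: "0 < q" by (simp add: q_def)
  have e: "e = m * d"
  proof -
    have "edges H = (\<lambda>(v, u). (u, v)) ` (SIGMA v:R. {u\<in>L. (u, v) \<in> edges H})"
      using E by force
    moreover have "inj_on (\<lambda>(v, u). (u, v)) (SIGMA v:R. {u\<in>L. (u, v) \<in> edges H})"
      by (auto simp: inj_on_def)
    ultimately have "e = card (SIGMA v:R. {u\<in>L. (u, v) \<in> edges H})"
      unfolding e_def by (metis (no_types, lifting) card_image)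
    also have "\<dots> = (\<Sum>v\<in>R. card {u\<in>L. (u, v) \<in> edges H})" using fin by simp
    finally show ?thesis using deg by (simp add: m_def)
  qed
  have e0: "0 < e" using e d t by simp

  \<comment> \<open>Left variables encode functions from the colours to four points, right variables
    encode colours.\<close>
  have "finite ({..<q} \<rightarrow>\<^sub>E {..<4::nat})" by (intro finite_PiE) auto
  moreover have "({..<q} \<rightarrow>\<^sub>E {..<4::nat}) \<noteq> {}" by (simp add: PiE_eq_empty_iff lessThan_4)
  ultimately obtain p where p: "uniform_map p ({..<q} \<rightarrow>\<^sub>E {..<4::nat})" by (rule uniform_map_exists)
  have "finite {..<q}" "{..<q} \<noteq> {}" using q by auto
  then obtain p' where p': "uniform_map p' {..<q}" by (rule uniform_map_exists)

  define ker :: "(nat \<Rightarrow> real) \<Rightarrow> real \<times> real \<Rightarrow> real" where "ker \<phi> = (\<lambda>(x, y). \<phi> (p x (p' y)))" for \<phi>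
  define N where "N \<phi> = graph_norm H (ker \<phi>)" for \<phi>
  have ker: "ker \<phi> \<in> kernels" for \<phi>
    unfolding ker_def using uniform_map_kernel[OF p p', of "\<lambda>c d. \<phi> (c d)"] .
  have density: "hom_density H (ker \<phi>) =
    (\<Sum>b\<in>R \<rightarrow>\<^sub>E {..<q}. \<Prod>u\<in>L. \<Prod>i<q. moment4 \<phi> (color_count H b u i)) / q ^ m" for \<phi>
    unfolding ker_def m_def L_def R_def
    by (rule hom_density_color_kernel[OF _ _ _ p p']) (use fin E in \<open>simp_all add: L_def R_def\<close>)
  have semi: "seminorm_on kernels (graph_norm H)" using norm by (simp add: norming_def)
  have N_add: "N (\<lambda>s. \<phi> s + \<psi> s) \<le> N \<phi> + N \<psi>" for \<phi> \<psi>
  proof -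
    have "ker (\<lambda>s. \<phi> s + \<psi> s) = (\<lambda>z. ker \<phi> z + ker \<psi> z)" by (auto simp: ker_def)
    thus ?thesis using semi ker by (simp add: N_def seminorm_on_def)
  qed
  have N_mult: "N (\<lambda>s. c * \<phi> s) = \<bar>c\<bar> * N \<phi>" for c \<phi>
  proof -
    have "ker (\<lambda>s. c * \<phi> s) = (\<lambda>z. c * ker \<phi> z)" by (auto simp: ker_def)
    thus ?thesis using semi ker by (simp add: N_def seminorm_on_def)
  qed
  have N_one: "N (\<lambda>_. 1) = 1"
  proof -
    have "hom_density H (ker (\<lambda>_. 1)) = 1"
      unfolding density using q fin by (simp add: moment4_def card_PiE m_def)
    thus ?thesis by (simp add: N_def graph_norm_def)
  qed

  \<comment> \<open>Odd moments of a character are 0 and even ones are 1, so the density of a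
    character counts \<open>C\<close>.\<close>
  define C where "C = {b\<in>R \<rightarrow>\<^sub>E {..<q}. \<forall>u\<in>L. \<forall>i<q. even (color_count H b u i)}"
  have finPi: "finite (R \<rightarrow>\<^sub>E {..<q})" using fin by (intro finite_PiE) auto
  define \<tau> where "\<tau> = real (card C) / q ^ m"
  have sign: "hom_density H (ker (sign4 j)) = \<tau>" if "j \<in> {1, 2, 3}" for j
  proof -
    have "(\<Prod>u\<in>L. \<Prod>i<q. moment4 (sign4 j) (color_count H b u i))
      = of_bool (\<forall>u\<in>L. \<forall>i<q. even (color_count H b u i))" for b
      using fin(1) by (simp add: moment4_sign4[OF that] prod_of_bool Ball_def)
    moreover have "C = (R \<rightarrow>\<^sub>E {..<q}) \<inter> {b. \<forall>u\<in>L. \<forall>i<q. even (color_count H b u i)}"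
      unfolding C_def by blast
    moreover have "(\<Sum>b\<in>R \<rightarrow>\<^sub>E {..<q}. of_bool (P b)) = real (card ((R \<rightarrow>\<^sub>E {..<q}) \<inter> {b. P b}))" for P
      unfolding card_eq_sum using finPi by (simp add: of_bool_def sum.If_cases)
    ultimately show ?thesis by (simp only: density \<tau>_def)
  qed
  \<comment> \<open>The power \<open>t\<close> avoids rounding: D t \<le> m - 1. The bound thus has
    one factor \<open>q\<close> less than q ^ m, and this factor yields the contradiction.\<close>
  have C_card: "card C ^ t \<le> q ^ (m - 1) * D ^ (m * t)"
  proof -
    have "card (b ` R) \<le> D" if b: "b \<in> C" for b
    proof -
      have "even (color_count H b u i)" if "u \<in> L" for u i
      proof (cases "i < q")
        case False
        hence empty: "{v \<in> R. (u, v) \<in> edges H \<and> b v = i} = {}" using b by (auto simp: C_def)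
        show ?thesis unfolding color_count_def R_def[symmetric] empty by simp
      qed (use b that in \<open>auto simp: C_def\<close>)
      hence "card (b ` R) * t \<le> m - 1" using few[of b] by (simp add: t_def m_def)
      thus ?thesis using t by (simp add: D_def less_eq_div_iff_mult_less_eq)
    qed
    hence "C \<subseteq> {b\<in>R \<rightarrow>\<^sub>E {..<q}. card (b ` R) \<le> D}" by (auto simp: C_def)
    hence "card C \<le> card {b\<in>R \<rightarrow>\<^sub>E {..<q}. card (b ` R) \<le> D}" using finPi by (intro card_mono) auto
    also have "\<dots> \<le> q ^ D * D ^ m"
      unfolding m_def by (rule card_few_values_le) (use fin R in auto)
    finally have "card C ^ t \<le> (q ^ D * D ^ m) ^ t" by (rule power_mono) simp
    also have "\<dots> = q ^ (D * t) * D ^ (m * t)" by (simp add: power_mult_distrib power_mult)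
    also have "\<dots> \<le> q ^ (m - 1) * D ^ (m * t)"
      using q by (intro mult_right_mono power_increasing) (auto simp: D_def)
    finally show ?thesis .
  qed
  \<comment> \<open>A character takes only the values 1 and -1, so density 0 would contradict the
    definiteness of the norm.\<close>
  have \<tau>_pos: "0 < \<tau>"
  proof (rule ccontr)
    assume "\<not> 0 < \<tau>"
    hence "\<tau> = 0" by (auto simp: \<tau>_def divide_less_0_iff zero_less_divide_iff)
    hence "graph_norm H (ker (sign4 1)) = 0" using sign[of 1] by (simp add: graph_norm_def)
    hence "AE z in unit_square. ker (sign4 1) z = 0" using norm ker by (simp add: norming_def)
    moreover have "ker (sign4 1) z \<noteq> 0" for z by (simp add: ker_def sign4_def split: prod.split)
    ultimately show False using not_AE_zero_unit_square by blast
  qed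
  have \<tau>_le: "\<tau> \<le> 1"
  proof -
    have "card C \<le> card (R \<rightarrow>\<^sub>E {..<q})" using finPi by (intro card_mono) (auto simp: C_def)
    hence "card C \<le> q ^ m" using fin by (simp add: card_PiE m_def)
    hence "real (card C) \<le> real q ^ m" by (metis of_nat_le_iff of_nat_power)
    thus ?thesis using q by (simp add: \<tau>_def)
  qed
  define \<nu> where "\<nu> = \<tau> powr (1 / e)"
  have \<nu>: "0 < \<nu>" "\<nu> \<le> 1" "\<nu> ^ e = \<tau>"
  proof -
    show "0 < \<nu>" using \<tau>_pos by (simp add: \<nu>_def)
    show "\<nu> \<le> 1" using \<tau>_pos \<tau>_le by (simp add: \<nu>_def powr_le1)
    show "\<nu> ^ e = \<tau>" using \<tau>_pos e0 by (simp add: \<nu>_def powr_realpow[symmetric] powr_powr)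
  qed
  have N_sign: "N (sign4 j) = \<nu>" if "j \<in> {1, 2, 3}" for j
    using sign[OF that] \<tau>_pos by (simp add: N_def graph_norm_def \<nu>_def e_def)
  define \<beta> where "\<beta> = 1 / \<nu>"
  have \<beta>: "1 \<le> \<beta>" "\<beta> * \<nu> = 1" using \<nu> by (auto simp: \<beta>_def)
  \<comment> \<open>Each character has norm \<nu> = 1 / \<beta>, so this function has norm at most 1
    + 3 = 4.\<close>
  define \<psi> where "\<psi> = (\<lambda>s. 1 + \<beta> * (sign4 1 s + sign4 2 s + sign4 3 s))"
  have "N \<psi> \<le> 4"
  proof -
    have "N (\<lambda>s. sign4 1 s + sign4 2 s + sign4 3 s) \<le> 3 * \<nu>"
      using N_add[of "\<lambda>s. sign4 1 s + sign4 2 s" "sign4 3"] N_add[of "sign4 1" "sign4 2"]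
        N_sign[of 1] N_sign[of 2] N_sign[of 3] by simp
    hence "\<beta> * N (\<lambda>s. sign4 1 s + sign4 2 s + sign4 3 s) \<le> \<beta> * (3 * \<nu>)"
      using \<beta> by (intro mult_left_mono) auto
    also have "\<dots> = 3" using \<beta> by simp
    finally have "\<bar>\<beta>\<bar> * N (\<lambda>s. sign4 1 s + sign4 2 s + sign4 3 s) \<le> 3" using \<beta> by simp
    moreover have "N \<psi> \<le> N (\<lambda>_. 1) + N (\<lambda>s. \<beta> * (sign4 1 s + sign4 2 s + sign4 3 s))"
      unfolding \<psi>_def by (rule N_add)
    ultimately show ?thesis unfolding N_mult N_one by linarith
  qed
  hence upper: "hom_density H (ker \<psi>) \<le> 4 ^ e"
  proof -
    let ?h = "\<bar>hom_density H (ker \<psi>)\<bar>"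
    have "?h = (?h powr (1 / e)) ^ e"
    proof (cases "?h = 0")
      case False
      thus ?thesis using e0 by (simp add: powr_realpow[symmetric] powr_powr)
    qed (use e0 in simp)
    also have "\<dots> \<le> 4 ^ e"
      using \<open>N \<psi> \<le> 4\<close> by (intro power_mono) (auto simp: N_def graph_norm_def e_def)
    finally show ?thesis by linarith
  qed

  \<comment> \<open>Colourings with the single colour \<open>i\<close> on \<open>T\<close> and free
    elsewhere. The \<open>q\<close> choices of \<open>i\<close> give disjoint sets, with q ^ (m - t
    + 1) colourings in total.\<close>
  define B where "B i = (\<Pi>\<^sub>E v\<in>R. if v \<in> T then {i} else {..<q})" for i :: nat
  have B_sub: "B i \<subseteq> R \<rightarrow>\<^sub>E {..<q}" if "i < q" for i
    unfolding B_def using that by (intro PiE_mono) auto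
  have B_card: "card (B i) = q ^ (m - t)" for i
  proof -
    have "card (B i) = (\<Prod>v\<in>R. if v \<in> T then 1 else q)"
      unfolding B_def using fin by (subst card_PiE) (auto intro!: prod.cong)
    also have "\<dots> = q ^ card (R - T)"
      using fin by (simp add: prod.If_cases Diff_eq Compl_eq)
    finally show ?thesis using finT T fin by (simp add: card_Diff_subset m_def t_def)
  qed
  obtain v0 where v0: "v0 \<in> T" using T by blast
  have B_disj: "B i \<inter> B j = {}" if "i \<noteq> j" for i j
  proof -
    have "b v0 = i" if "b \<in> B i" for b i
      using PiE_mem[OF that[unfolded B_def], of v0] v0 T by auto
    thus ?thesis using that by blast
  qed
  have moment: "\<beta> ^ k \<le> moment4 \<psi> M" if "k \<le> M" "k \<noteq> 1" for k M
    unfolding \<psi>_def by (rule moment4_sign4_sum_ge) (use that \<beta> in auto)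
  have moment1: "1 \<le> moment4 \<psi> M" for M using moment[of 0 M] by simp
  have term_ge: "\<beta> ^ (t * d) \<le> (\<Prod>u\<in>L. \<Prod>i<q. moment4 \<psi> (color_count H b u i))"
    if b: "b \<in> B j" and j: "j < q" for b j
  proof -
    have bT: "b v = j" if "v \<in> T" for v
      using PiE_mem[OF b[unfolded B_def], of v] that T by auto
    \<comment> \<open>The t d edges at \<open>T\<close> are counted twice. A left vertex contributes
      \<beta> to the number of its neighbours in \<open>T\<close> through colour \<open>j\<close>,
      as that number is never 1; the other colours contribute at least 1.\<close>
    have "(\<Sum>u\<in>L. card {v\<in>T. (u, v) \<in> edges H}) = (\<Sum>v\<in>T. card {u\<in>L. (u, v) \<in> edges H})"
      using sum.swap_restrict[OF fin(1) finT, of "\<lambda>_ _. 1::nat" "\<lambda>u v. (u, v) \<in> edges H"] by simp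
    also have "\<dots> = t * d" using deg T by (simp add: t_def subset_iff)
    finally have "\<beta> ^ (t * d) = \<beta> ^ (\<Sum>u\<in>L. card {v\<in>T. (u, v) \<in> edges H})" by simp
    also have "\<dots> = (\<Prod>u\<in>L. \<beta> ^ card {v\<in>T. (u, v) \<in> edges H})" by (rule power_sum)
    also have "\<dots> = (\<Prod>u\<in>L. \<Prod>i<q. if i = j then \<beta> ^ card {v\<in>T. (u, v) \<in> edges H} else 1)"
      using j by (simp add: prod.delta)
    also have "\<dots> \<le> (\<Prod>u\<in>L. \<Prod>i<q. moment4 \<psi> (color_count H b u i))"
    proof (intro prod_mono conjI prod_nonneg ballI)
      fix u i assume u: "u \<in> L"
      have "card {v\<in>T. (u, v) \<in> edges H} \<le> color_count H b u j"
        unfolding color_count_def using fin bT T by (intro card_mono) (auto simp: R_def)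
      thus "(if i = j then \<beta> ^ card {v\<in>T. (u, v) \<in> edges H} else 1) \<le> moment4 \<psi> (color_count H b u i)"
        using moment T(3)[OF u] moment1 by simp
    qed (use \<beta> in simp_all)
    finally show ?thesis .
  qed
  have lower: "q ^ (m - t + 1) * \<beta> ^ (t * d) \<le> 4 ^ e * real q ^ m"
  proof -
    let ?P = "\<lambda>b. \<Prod>u\<in>L. \<Prod>i<q. moment4 \<psi> (color_count H b u i)"
    have finB: "finite (B i)" if "i < q" for i using B_sub[OF that] finPi by (rule finite_subset)
    have "q ^ (m - t + 1) * \<beta> ^ (t * d) = (\<Sum>i<q. \<Sum>b\<in>B i. \<beta> ^ (t * d))"
      by (simp add: B_card)
    also have "\<dots> \<le> (\<Sum>i<q. \<Sum>b\<in>B i. ?P b)"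
      by (intro sum_mono term_ge) auto
    also have "\<dots> = (\<Sum>b\<in>(\<Union>i<q. B i). ?P b)"
      using finB B_disj by (intro sum.UNION_disjoint[symmetric]) auto
    also have "\<dots> \<le> (\<Sum>b\<in>R \<rightarrow>\<^sub>E {..<q}. ?P b)"
    proof (intro sum_mono2 finPi)
      show "(\<Union>i<q. B i) \<subseteq> R \<rightarrow>\<^sub>E {..<q}" using B_sub by blast
      show "0 \<le> ?P b" for b using moment1 by (intro prod_nonneg ballI) (meson order_trans zero_le_one)
    qed
    also have "\<dots> = hom_density H (ker \<psi>) * real q ^ m" using q by (simp add: density)
    also have "\<dots> \<le> 4 ^ e * real q ^ m" using upper by (intro mult_right_mono) auto
    finally show ?thesis .
  qed
  \<comment> \<open>Since e = m d, the power \<open>m\<close> makes \<open>e\<close> a factor of the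
    exponent of \<beta>. Then \<beta> \<nu> = 1 and \<nu> ^ e = \<tau> trade \<beta> for \<tau>,
    that is, for the size of \<open>C\<close>.\<close>
  have "(real q ^ (m - t + 1) * \<beta> ^ (t * d)) ^ m \<le> (4 ^ e * real q ^ m) ^ m"
    using lower \<beta> by (intro power_mono) auto
  moreover have "t * d * m = t * e" by (simp add: e)
  ultimately have "real q ^ ((m - t + 1) * m) * \<beta> ^ (t * e) \<le> 4 ^ (e * m) * real q ^ (m * m)"
    by (simp only: power_mult_distrib power_mult[symmetric])
  hence "real q ^ ((m - t + 1) * m) * \<beta> ^ (t * e) * \<nu> ^ (t * e) \<le> 4 ^ (e * m) * real q ^ (m * m) * \<nu> ^ (t * e)"
    using \<nu> by (intro mult_right_mono) auto
  moreover have "\<beta> ^ (t * e) * \<nu> ^ (t * e) = 1"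
    using \<beta> by (simp add: power_mult_distrib[symmetric])
  moreover have "\<nu> ^ (t * e) = \<tau> ^ t" using \<nu>(3) by (simp add: mult.commute[of t] power_mult)
  ultimately have "real q ^ ((m - t + 1) * m) \<le> 4 ^ (e * m) * real q ^ (m * m) * \<tau> ^ t"
    by (simp add: mult.assoc)
  hence "real q ^ ((m - t + 1) * m) * real q ^ (m * t) \<le> 4 ^ (e * m) * real q ^ (m * m) * \<tau> ^ t * real q ^ (m * t)"
    by (intro mult_right_mono) auto
  also have "\<tau> ^ t * real q ^ (m * t) = real (card C ^ t)"
    using q by (simp add: \<tau>_def power_divide power_mult)
  hence "4 ^ (e * m) * real q ^ (m * m) * \<tau> ^ t * real q ^ (m * t) = 4 ^ (e * m) * real q ^ (m * m) * real (card C ^ t)"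
    by (simp only: mult.assoc)
  also have "\<dots> \<le> 4 ^ (e * m) * real q ^ (m * m) * real (q ^ (m - 1) * D ^ (m * t))"
    using C_card by (intro mult_left_mono) (simp_all only: of_nat_le_iff, simp)
  finally have "real (q ^ ((m - t + 1) * m) * q ^ (m * t))
      \<le> real (4 ^ (e * m) * q ^ (m * m) * (q ^ (m - 1) * D ^ (m * t)))"
    by simp
  hence "q ^ ((m - t + 1) * m) * q ^ (m * t) \<le> 4 ^ (e * m) * q ^ (m * m) * (q ^ (m - 1) * D ^ (m * t))"
    by (simp only: of_nat_le_iff)
  \<comment> \<open>The left exponent is m m + m, exactly one more than the exponent of
    \<open>q\<close> on the right, so that \<open>q\<close> itself gets bounded.\<close>
  moreover have "q ^ ((m - t + 1) * m) * q ^ (m * t) = q ^ (m * m + (m - 1)) * q"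
  proof -
    obtain k where k: "m = t + k" using t(2) le_Suc_ex by blast
    have "(m - t + 1) * m + m * t = m * m + m" unfolding k by (simp add: algebra_simps)
    hence "(m - t + 1) * m + m * t = m * m + (m - 1) + 1" using t by simp
    thus ?thesis by (metis power_add power_one_right)
  qed
  ultimately have "q ^ (m * m + (m - 1)) * q \<le> q ^ (m * m + (m - 1)) * (4 ^ (e * m) * D ^ (m * t))"
    by (simp add: power_add mult_ac)
  hence "q \<le> 4 ^ (e * m) * D ^ (m * t)" using q by simp
  thus False by (simp add: q_def)
qed

section \<open>Bipartite Kneser graphs other than the 6-cycle\<close>

lemma card_supersets:
  assumes "finite S" "Y \<subseteq> S" "card Y \<le> k"
  shows "card {X. X \<subseteq> S \<and> card X = k \<and> Y \<subseteq> X} = (card S - card Y) choose (k - card Y)"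
proof -
  have finY: "finite Y" using assms finite_subset by blast
  have "bij_betw (\<lambda>W. W \<union> Y) {W. W \<subseteq> S - Y \<and> card W = k - card Y} {X. X \<subseteq> S \<and> card X = k \<and> Y \<subseteq> X}"
  proof (rule bij_betwI[where g = "\<lambda>X. X - Y"])
    show "(\<lambda>W. W \<union> Y) \<in> {W. W \<subseteq> S - Y \<and> card W = k - card Y} \<rightarrow> {X. X \<subseteq> S \<and> card X = k \<and> Y \<subseteq> X}"
    proof
      fix W assume "W \<in> {W. W \<subseteq> S - Y \<and> card W = k - card Y}"
      hence W: "W \<subseteq> S - Y" "card W = k - card Y" by auto
      hence "finite W" "W \<inter> Y = {}" using assms(1) finite_subset[of W S] by auto
      hence "card (W \<union> Y) = k" using W finY assms(3) by (simp add: card_Un_disjoint)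
      thus "W \<union> Y \<in> {X. X \<subseteq> S \<and> card X = k \<and> Y \<subseteq> X}" using W assms(2) by blast
    qed
    show "(\<lambda>X. X - Y) \<in> {X. X \<subseteq> S \<and> card X = k \<and> Y \<subseteq> X} \<rightarrow> {W. W \<subseteq> S - Y \<and> card W = k - card Y}"
      using finY by (auto simp: card_Diff_subset)
  qed blast+
  hence "card {X. X \<subseteq> S \<and> card X = k \<and> Y \<subseteq> X} = card {W. W \<subseteq> S - Y \<and> card W = k - card Y}"
    by (simp add: bij_betw_same_card)
  also have "\<dots> = card (S - Y) choose (k - card Y)" using assms(1) by (simp add: n_subsets)
  finally show ?thesis using assms(2) finY by (simp add: card_Diff_subset)
qed

lemma bipartite_kneser_simps:
  "left_part (bipartite_kneser n r) = {X. X \<subseteq> {1..n} \<and> card X = n - r}"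
  "right_part (bipartite_kneser n r) = {Y. Y \<subseteq> {1..n} \<and> card Y = r}"
  "(X, Y) \<in> edges (bipartite_kneser n r) \<longleftrightarrow>
    X \<subseteq> {1..n} \<and> card X = n - r \<and> Y \<subseteq> {1..n} \<and> card Y = r \<and> Y \<subseteq> X"
  by (auto simp: bipartite_kneser_def set_inclusion_graph_def)

text \<open>\<open>T\<close> is the star with r + 2 members over the core {1, ..., r - 1}. An (n -
  r)-set without the core contains no member; one that includes the core omits only r points, and so
  contains at least two members.\<close>

lemma bipartite_kneser_not_norming:
  assumes n: "2 * r < n" and r: "1 \<le> r" and nr: "(n, r) \<noteq> (3, 1)"
  shows "\<not> norming (bipartite_kneser n r)"
proof -
  let ?H = "bipartite_kneser n r"
  define R where "R = {Y. Y \<subseteq> {1..n} \<and> card Y = r}"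
  define A where "A = {1..<r}"
  define T where "T = (\<lambda>y. insert y A) ` {r..2 * r + 1}"
  have inj: "inj_on (\<lambda>y. insert y A) {r..2 * r + 1}" by (auto simp: inj_on_def A_def)
  have cT: "card T = r + 2" unfolding T_def card_image[OF inj] by simp
  show ?thesis
  proof (rule not_norming_criterion)
    show "finite (left_part ?H)" "finite (right_part ?H)"
      unfolding bipartite_kneser_simps by (rule finite_subset[of _ "Pow {1..n}"]; auto)+
    show "edges ?H \<subseteq> left_part ?H \<times> right_part ?H"
      by (auto simp only: bipartite_kneser_simps mem_Times_iff mem_Collect_eq fst_conv snd_conv)
    show "card {u \<in> left_part ?H. (u, v) \<in> edges ?H} = (n - r) choose (n - r - r)"
      if "v \<in> right_part ?H" for v
    proof -
      have v: "v \<subseteq> {1..n}" "card v = r" using that by (auto simp: bipartite_kneser_simps)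
      have "{u \<in> left_part ?H. (u, v) \<in> edges ?H} = {X. X \<subseteq> {1..n} \<and> card X = n - r \<and> v \<subseteq> X}"
        using v by (auto simp: bipartite_kneser_simps)
      thus ?thesis using card_supersets[OF _ v(1), of "n - r"] v n by simp
    qed
    show "0 < (n - r) choose (n - r - r)" by simp
    show "T \<subseteq> right_part ?H"
    proof
      fix Y assume "Y \<in> T"
      then obtain y where y: "y \<in> {r..2 * r + 1}" "Y = insert y A" by (auto simp: T_def)
      have "card Y = r" using y r by (auto simp: A_def)
      moreover have "Y \<subseteq> {1..n}" using y n r by (auto simp: A_def)
      ultimately show "Y \<in> right_part ?H" by (simp add: bipartite_kneser_simps)
    qed
    show "T \<noteq> {}" by (simp add: T_def)
    show "card {v \<in> T. (u, v) \<in> edges ?H} \<noteq> 1" if "u \<in> left_part ?H" for u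
    proof -
      have u: "u \<subseteq> {1..n}" "card u = n - r" "finite u"
        using that by (auto simp: bipartite_kneser_simps intro: finite_subset)
      have eq: "{v \<in> T. (u, v) \<in> edges ?H} = {v \<in> T. v \<subseteq> u}"
        using \<open>T \<subseteq> right_part ?H\<close> u by (auto simp: bipartite_kneser_simps)
      show ?thesis
      proof (cases "A \<subseteq> u")
        case True
        let ?V = "{r..2 * r + 1}"
        have "{v \<in> T. v \<subseteq> u} = (\<lambda>y. insert y A) ` (?V \<inter> u)"
          using True by (auto simp: T_def)
        moreover have "inj_on (\<lambda>y. insert y A) (?V \<inter> u)" using inj by (rule inj_on_subset) blast
        ultimately have c: "card {v \<in> T. v \<subseteq> u} = card (?V \<inter> u)" by (simp add: card_image)
        have "card (?V - u) \<le> card ({1..n} - u)"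
          using r n by (intro card_mono) auto
        also have "\<dots> = r" using u n by (simp add: card_Diff_subset)
        finally have "card (?V - u) \<le> r" .
        moreover have "card ?V = card (?V \<inter> u) + card (?V - u)"
          using card_Int_Diff[of ?V u] by simp
        ultimately show ?thesis unfolding eq c by simp
      next
        case False
        hence empty: "{v \<in> T. v \<subseteq> u} = {}" by (auto simp: T_def)
        show ?thesis unfolding eq empty by simp
      qed
    qed
    show "card (b ` right_part ?H) * card T < card (right_part ?H)"
      if "\<And>u i. u \<in> left_part ?H \<Longrightarrow> even (color_count ?H b u i)" for b
    proof -
      have "even_family n r {Y\<in>R. b Y = i}" for i
        unfolding even_family_def
      proof (intro conjI allI impI)
        show "\<forall>Y\<in>{Y\<in>R. b Y = i}. Y \<subseteq> {1..n} \<and> card Y = r" by (simp add: R_def)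
        fix X assume X: "X \<subseteq> {1..n} \<and> card X = n - r"
        have "{Y\<in>{Y\<in>R. b Y = i}. Y \<subseteq> X} = {v\<in>right_part ?H. (X, v) \<in> edges ?H \<and> b v = i}"
          using X by (auto simp: R_def bipartite_kneser_simps)
        thus "even (card {Y\<in>{Y\<in>R. b Y = i}. Y \<subseteq> X})"
          using that[of X i] X by (simp add: color_count_def bipartite_kneser_simps)
      qed
      thus ?thesis
        using even_coloring_few_colors[OF n r nr, of b] by (simp add: R_def bipartite_kneser_simps cT)
    qed
  qed
qed

section \<open>The 6-cycle and the Schatten 6-norm\<close>

locale kernel_space = prob_space
begin

text \<open>Kernels vanish off the square, so that their composition is associative at every point.\<close>

definition bounded_kernels :: "('a \<times> 'a \<Rightarrow> real) set" where
  "bounded_kernels = {f \<in> borel_measurable (M \<Otimes>\<^sub>M M).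
     (\<exists>B. \<forall>z. \<bar>f z\<bar> \<le> B) \<and> (\<forall>z. z \<notin> space (M \<Otimes>\<^sub>M M) \<longrightarrow> f z = 0)}"

definition kernel_comp :: "('a \<times> 'a \<Rightarrow> real) \<Rightarrow> ('a \<times> 'a \<Rightarrow> real) \<Rightarrow> 'a \<times> 'a \<Rightarrow> real" (infixl "\<odot>" 70) where
  "f \<odot> g = (\<lambda>(u, w). \<integral>v. f (u, v) * g (v, w) \<partial>M)"

definition kernel_transpose :: "('a \<times> 'a \<Rightarrow> real) \<Rightarrow> 'a \<times> 'a \<Rightarrow> real" ("_\<^sup>t" [1000] 1000) where
  "f\<^sup>t = (\<lambda>(u, v). f (v, u))"

text \<open>The Hilbert--Schmidt inner product, i.e. the trace of
  \<open>f \<odot> g\<^sup>t\<close>.\<close>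

definition kernel_inner :: "('a \<times> 'a \<Rightarrow> real) \<Rightarrow> ('a \<times> 'a \<Rightarrow> real) \<Rightarrow> real" where
  "kernel_inner f g = (\<integral>u. (\<integral>v. f (u, v) * g (u, v) \<partial>M) \<partial>M)"

lemma pair_prob: "pair_prob_space M M"
  by (simp add: pair_prob_space_def pair_sigma_finite_def prob_space_axioms prob_space_imp_sigma_finite)

lemma bounded_kernelsD:
  assumes "f \<in> bounded_kernels"
  shows "f \<in> borel_measurable (M \<Otimes>\<^sub>M M)" "\<exists>B. \<forall>z. \<bar>f z\<bar> \<le> B"
    "u \<notin> space M \<Longrightarrow> f (u, v) = 0" "v \<notin> space M \<Longrightarrow> f (u, v) = 0"
  using assms by (auto simp: bounded_kernels_def space_pair_measure)

lemma bounded_kernelsI: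
  assumes "f \<in> borel_measurable (M \<Otimes>\<^sub>M M)" "\<And>z. \<bar>f z\<bar> \<le> B"
    "\<And>u v. u \<notin> space M \<or> v \<notin> space M \<Longrightarrow> f (u, v) = 0"
  shows "f \<in> bounded_kernels"
proof -
  have "f z = 0" if "z \<notin> space M \<times> space M" for z using assms(3) that by (cases z) auto
  thus ?thesis using assms(1,2) unfolding bounded_kernels_def space_pair_measure mem_Collect_eq
    by blast
qed

lemma integrable_bounded:
  fixes f :: "'a \<Rightarrow> real"
  assumes "f \<in> borel_measurable M" "\<And>x. \<bar>f x\<bar> \<le> B"
  shows "integrable M f"
  using assms by (intro integrable_const_bound[of _ B]) auto

lemma measurable_kernel_section:
  assumes "f \<in> bounded_kernels"
  shows "(\<lambda>v. f (u, v)) \<in> borel_measurable M" "(\<lambda>u. f (u, v)) \<in> borel_measurable M"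
proof -
  note [measurable] = bounded_kernelsD(1)[OF assms]
  show "(\<lambda>v. f (u, v)) \<in> borel_measurable M"
  proof (cases "u \<in> space M")
    case True thus ?thesis by measurable
  qed (simp add: bounded_kernelsD(3)[OF assms])
  show "(\<lambda>u. f (u, v)) \<in> borel_measurable M"
  proof (cases "v \<in> space M")
    case True thus ?thesis by measurable
  qed (simp add: bounded_kernelsD(4)[OF assms])
qed

lemma transpose_transpose [simp]: "(f\<^sup>t)\<^sup>t = f"
  by (auto simp: kernel_transpose_def)

lemma transpose_apply [simp]: "f\<^sup>t (u, v) = f (v, u)"
  by (simp add: kernel_transpose_def)

lemma transpose_comp: "(f \<odot> g)\<^sup>t = g\<^sup>t \<odot> f\<^sup>t"
  by (auto simp: kernel_transpose_def kernel_comp_def mult.commute)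

lemma transpose_bounded_kernel [simp]:
  assumes f: "f \<in> bounded_kernels"
  shows "f\<^sup>t \<in> bounded_kernels"
proof -
  have "(\<lambda>(u, v). f (v, u)) \<in> borel_measurable (M \<Otimes>\<^sub>M M)"
    using bounded_kernelsD(1)[OF f] by measurable
  moreover obtain B where "\<And>z. \<bar>f z\<bar> \<le> B" using bounded_kernelsD(2)[OF f] by blast
  ultimately show ?thesis unfolding kernel_transpose_def
    using bounded_kernelsD(3,4)[OF f] by (intro bounded_kernelsI[of _ B]) auto
qed

lemma comp_bounded_kernel [simp]:
  assumes f: "f \<in> bounded_kernels" and g: "g \<in> bounded_kernels"
  shows "f \<odot> g \<in> bounded_kernels"
proof -
  obtain B where B: "\<And>z. \<bar>f z\<bar> \<le> B" using bounded_kernelsD(2)[OF f] by blast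
  obtain C where C: "\<And>z. \<bar>g z\<bar> \<le> C" using bounded_kernelsD(2)[OF g] by blast
  note [measurable] = bounded_kernelsD(1)[OF f] bounded_kernelsD(1)[OF g]
  have "(\<lambda>(u, w). \<integral>v. f (u, v) * g (v, w) \<partial>M) \<in> borel_measurable (M \<Otimes>\<^sub>M M)"
    by measurable
  moreover have "\<bar>\<integral>v. f (u, v) * g (v, w) \<partial>M\<bar> \<le> B * C" for u w
  proof -
    have le: "\<bar>f (u, v) * g (v, w)\<bar> \<le> B * C" for v
      unfolding abs_mult using B[of "(u, v)"] C[of "(v, w)"] by (intro mult_mono) auto
    have "integrable M (\<lambda>v. f (u, v) * g (v, w))"
      using measurable_kernel_section[OF f] measurable_kernel_section[OF g] le
      by (intro integrable_bounded) auto
    hence "\<bar>\<integral>v. f (u, v) * g (v, w) \<partial>M\<bar> \<le> (\<integral>v. B * C \<partial>M)"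
      by (intro order_trans[OF integral_abs_bound] integral_mono) (use le in auto)
    thus ?thesis by (simp add: prob_space)
  qed
  moreover have "(\<integral>v. f (u, v) * g (v, w) \<partial>M) = 0" if "u \<notin> space M \<or> w \<notin> space M" for u w
    using that bounded_kernelsD(3)[OF f] bounded_kernelsD(4)[OF g] by auto
  ultimately show ?thesis
    unfolding kernel_comp_def by (intro bounded_kernelsI[of _ "B * C"]) auto
qed

lemma integral_swap_bounded:
  fixes h :: "'a \<Rightarrow> 'a \<Rightarrow> real"
  assumes "case_prod h \<in> borel_measurable (M \<Otimes>\<^sub>M M)" "\<And>x y. \<bar>h x y\<bar> \<le> B"
  shows "(\<integral>x. \<integral>y. h x y \<partial>M \<partial>M) = (\<integral>y. \<integral>x. h x y \<partial>M \<partial>M)"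
proof -
  interpret pair_prob_space M M by (rule pair_prob)
  have "integrable (M \<Otimes>\<^sub>M M) (case_prod h)"
    using assms by (intro P.integrable_const_bound[of _ B]) auto
  from Fubini_integral[OF this] show ?thesis by simp
qed

lemma kernel_inner_eq:
  assumes f: "f \<in> bounded_kernels" and g: "g \<in> bounded_kernels"
  shows "integrable (M \<Otimes>\<^sub>M M) (\<lambda>z. f z * g z)"
    and "kernel_inner f g = (\<integral>z. f z * g z \<partial>(M \<Otimes>\<^sub>M M))"
proof -
  interpret pair_prob_space M M by (rule pair_prob)
  obtain B where B: "\<And>z. \<bar>f z\<bar> \<le> B" using bounded_kernelsD(2)[OF f] by blast
  obtain C where C: "\<And>z. \<bar>g z\<bar> \<le> C" using bounded_kernelsD(2)[OF g] by blast
  note [measurable] = bounded_kernelsD(1)[OF f] bounded_kernelsD(1)[OF g]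
  have le: "\<bar>f z * g z\<bar> \<le> B * C" for z
    unfolding abs_mult using B[of z] C[of z] by (intro mult_mono) auto
  show int: "integrable (M \<Otimes>\<^sub>M M) (\<lambda>z. f z * g z)"
    using le by (intro P.integrable_const_bound[of _ "B * C"]) auto
  show "kernel_inner f g = (\<integral>z. f z * g z \<partial>(M \<Otimes>\<^sub>M M))"
    unfolding kernel_inner_def using integral_fst'[OF int] by simp
qed

lemma kernel_inner_commute: "kernel_inner f g = kernel_inner g f"
  by (simp add: kernel_inner_def mult.commute)

lemma kernel_inner_transpose:
  assumes f: "f \<in> bounded_kernels" and g: "g \<in> bounded_kernels"
  shows "kernel_inner (f\<^sup>t) (g\<^sup>t) = kernel_inner f g"
proof -
  obtain B where B: "\<And>z. \<bar>f z\<bar> \<le> B" using bounded_kernelsD(2)[OF f] by blast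
  obtain C where C: "\<And>z. \<bar>g z\<bar> \<le> C" using bounded_kernelsD(2)[OF g] by blast
  note [measurable] = bounded_kernelsD(1)[OF f] bounded_kernelsD(1)[OF g]
  have "\<bar>f z * g z\<bar> \<le> B * C" for z
    unfolding abs_mult using B[of z] C[of z] by (intro mult_mono) auto
  thus ?thesis
    unfolding kernel_inner_def transpose_apply
    by (intro integral_swap_bounded[of "\<lambda>u v. f (v, u) * g (v, u)" "B * C"]) auto
qed

lemma kernel_comp_assoc:
  assumes f: "f \<in> bounded_kernels" and g: "g \<in> bounded_kernels" and h: "h \<in> bounded_kernels"
  shows "(f \<odot> g) \<odot> h = f \<odot> (g \<odot> h)"
proof (rule ext, clarify)
  fix u w
  obtain B where B: "\<And>z. \<bar>f z\<bar> \<le> B" using bounded_kernelsD(2)[OF f] by blast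
  obtain C where C: "\<And>z. \<bar>g z\<bar> \<le> C" using bounded_kernelsD(2)[OF g] by blast
  obtain D where D: "\<And>z. \<bar>h z\<bar> \<le> D" using bounded_kernelsD(2)[OF h] by blast
  note [measurable] = bounded_kernelsD(1)[OF g] measurable_kernel_section(1)[OF f]
    measurable_kernel_section(2)[OF h]
  have "\<bar>f (u, v) * g (v, x) * h (x, w)\<bar> \<le> B * C * D" for v x
  proof -
    have "0 \<le> B" "0 \<le> C" using B[of undefined] C[of undefined] by auto
    thus ?thesis unfolding abs_mult
      using B[of "(u, v)"] C[of "(v, x)"] D[of "(x, w)"] by (intro mult_mono) auto
  qed
  hence "(\<integral>x. \<integral>v. f (u, v) * g (v, x) * h (x, w) \<partial>M \<partial>M) = (\<integral>v. \<integral>x. f (u, v) * g (v, x) * h (x, w) \<partial>M \<partial>M)"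
    by (intro integral_swap_bounded[of "\<lambda>x v. f (u, v) * g (v, x) * h (x, w)" "B * C * D"]) auto
  moreover have "((f \<odot> g) \<odot> h) (u, w) = (\<integral>x. \<integral>v. f (u, v) * g (v, x) * h (x, w) \<partial>M \<partial>M)"
    by (simp add: kernel_comp_def)
  moreover have "(f \<odot> (g \<odot> h)) (u, w) = (\<integral>v. \<integral>x. f (u, v) * g (v, x) * h (x, w) \<partial>M \<partial>M)"
    by (simp add: kernel_comp_def mult.assoc)
  ultimately show "((f \<odot> g) \<odot> h) (u, w) = (f \<odot> (g \<odot> h)) (u, w)" by simp
qed

text \<open>By Fubini, right composition with \<open>g\<close> has right composition with
  \<open>g\<^sup>t\<close> as its adjoint. Such moves shift the place where a cyclic word of kernels
  is cut.\<close>

lemma kernel_inner_comp_left: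
  assumes f: "f \<in> bounded_kernels" and g: "g \<in> bounded_kernels" and h: "h \<in> bounded_kernels"
  shows "kernel_inner (f \<odot> g) h = kernel_inner f (h \<odot> g\<^sup>t)"
proof -
  obtain B where B: "\<And>z. \<bar>f z\<bar> \<le> B" using bounded_kernelsD(2)[OF f] by blast
  obtain C where C: "\<And>z. \<bar>g z\<bar> \<le> C" using bounded_kernelsD(2)[OF g] by blast
  obtain D where D: "\<And>z. \<bar>h z\<bar> \<le> D" using bounded_kernelsD(2)[OF h] by blast
  note [measurable] = bounded_kernelsD(1)[OF g] measurable_kernel_section(1)[OF f]
    measurable_kernel_section(1)[OF h]
  have "(\<integral>w. \<integral>v. f (u, v) * (h (u, w) * g (v, w)) \<partial>M \<partial>M) = (\<integral>v. \<integral>w. f (u, v) * (h (u, w) * g (v, w)) \<partial>M \<partial>M)" for u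
  proof -
    have "\<bar>f (u, v) * (h (u, w) * g (v, w))\<bar> \<le> B * (D * C)" for v w
    proof -
      have "0 \<le> B" "0 \<le> D" using B[of undefined] D[of undefined] by auto
      thus ?thesis unfolding abs_mult
        using B[of "(u, v)"] C[of "(v, w)"] D[of "(u, w)"] by (intro mult_mono) auto
    qed
    thus ?thesis
      by (intro integral_swap_bounded[of "\<lambda>w v. f (u, v) * (h (u, w) * g (v, w))" "B * (D * C)"]) auto
  qed
  moreover have "(f \<odot> g) (u, w) * h (u, w) = (\<integral>v. f (u, v) * (h (u, w) * g (v, w)) \<partial>M)" for u w
  proof -
    have "f (u, v) * (h (u, w) * g (v, w)) = f (u, v) * g (v, w) * h (u, w)" for v by simp
    thus ?thesis by (simp only: kernel_comp_def prod.case integral_mult_left_zero)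
  qed
  moreover have "f (u, v) * (h \<odot> g\<^sup>t) (u, v) = (\<integral>w. f (u, v) * (h (u, w) * g (v, w)) \<partial>M)" for u v
    by (simp add: kernel_comp_def)
  ultimately show ?thesis by (simp only: kernel_inner_def)
qed

lemma kernel_inner_comp_right:
  assumes f: "f \<in> bounded_kernels" and g: "g \<in> bounded_kernels" and h: "h \<in> bounded_kernels"
  shows "kernel_inner (f \<odot> g) h = kernel_inner g (f\<^sup>t \<odot> h)"
proof -
  have "kernel_inner (f \<odot> g) h = kernel_inner (g\<^sup>t \<odot> f\<^sup>t) (h\<^sup>t)"
    using kernel_inner_transpose[of "f \<odot> g" h] assms by (simp add: transpose_comp)
  also have "\<dots> = kernel_inner (g\<^sup>t) (h\<^sup>t \<odot> f)"
    using kernel_inner_comp_left[of "g\<^sup>t" "f\<^sup>t" "h\<^sup>t"] assms by simp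
  also have "\<dots> = kernel_inner g (f\<^sup>t \<odot> h)"
    using kernel_inner_transpose[of g "f\<^sup>t \<odot> h"] assms by (simp add: transpose_comp)
  finally show ?thesis .
qed

lemma kernel_inner_nonneg: "0 \<le> kernel_inner f f"
  unfolding kernel_inner_def by (intro Bochner_Integration.integral_nonneg) simp

lemma bounded_kernels_add [simp]:
  assumes f: "f \<in> bounded_kernels" and g: "g \<in> bounded_kernels"
  shows "(\<lambda>z. f z + g z) \<in> bounded_kernels"
proof -
  obtain B where B: "\<And>z. \<bar>f z\<bar> \<le> B" using bounded_kernelsD(2)[OF f] by blast
  obtain C where C: "\<And>z. \<bar>g z\<bar> \<le> C" using bounded_kernelsD(2)[OF g] by blast
  have "\<bar>f z + g z\<bar> \<le> B + C" for z
    using B[of z] C[of z] by linarith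
  thus ?thesis using bounded_kernelsD[OF f] bounded_kernelsD[OF g]
    by (intro bounded_kernelsI[of _ "B + C"]) auto
qed

lemma bounded_kernels_mult [simp]:
  assumes f: "f \<in> bounded_kernels"
  shows "(\<lambda>z. c * f z) \<in> bounded_kernels"
proof -
  obtain B where B: "\<And>z. \<bar>f z\<bar> \<le> B" using bounded_kernelsD(2)[OF f] by blast
  have "\<bar>c * f z\<bar> \<le> \<bar>c\<bar> * B" for z
    unfolding abs_mult using B[of z] by (intro mult_left_mono) auto
  thus ?thesis using bounded_kernelsD[OF f] by (intro bounded_kernelsI[of _ "\<bar>c\<bar> * B"]) auto
qed

lemma kernel_inner_add:
  assumes "f \<in> bounded_kernels" "g \<in> bounded_kernels" "h \<in> bounded_kernels"
  shows "kernel_inner (\<lambda>z. f z + g z) h = kernel_inner f h + kernel_inner g h"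
  using assms by (simp add: kernel_inner_eq distrib_right)

lemma kernel_inner_mult: "kernel_inner (\<lambda>z. c * f z) h = c * kernel_inner f h"
  by (simp add: kernel_inner_def mult.assoc)

lemma kernel_inner_Cauchy_Schwarz:
  assumes f: "f \<in> bounded_kernels" and g: "g \<in> bounded_kernels"
  shows "(kernel_inner f g)\<^sup>2 \<le> kernel_inner f f * kernel_inner g g"
proof -
  have quad: "0 \<le> s\<^sup>2 * kernel_inner f f + 2 * s * t * kernel_inner f g + t\<^sup>2 * kernel_inner g g" for s t
  proof -
    let ?h = "\<lambda>z. s * f z + t * g z"
    have expand: "kernel_inner ?h k = s * kernel_inner f k + t * kernel_inner g k"
      if "k \<in> bounded_kernels" for k
      using kernel_inner_add[of "\<lambda>z. s * f z" "\<lambda>z. t * g z" k] assms that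
      by (simp add: kernel_inner_mult)
    have "kernel_inner ?h ?h = s * kernel_inner ?h f + t * kernel_inner ?h g"
      using expand[of ?h] assms kernel_inner_commute[of f ?h] kernel_inner_commute[of g ?h] by simp
    also have "\<dots> = s\<^sup>2 * kernel_inner f f + 2 * s * t * kernel_inner f g + t\<^sup>2 * kernel_inner g g"
      unfolding expand[OF f] expand[OF g] kernel_inner_commute[of g f]
      by (simp add: power2_eq_square algebra_simps)
    finally show ?thesis using kernel_inner_nonneg[of ?h] by simp
  qed
  let ?a = "kernel_inner f f" and ?b = "kernel_inner f g" and ?c = "kernel_inner g g"
  have c0: "0 \<le> ?c" by (rule kernel_inner_nonneg)
  show ?thesis
  proof (cases "?c = 0")
    case True
    have "?b = 0"
    proof (rule ccontr)
      assume "?b \<noteq> 0"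
      \<comment> \<open>The form is only semidefinite, so c = 0 needs its own argument: at s = 1
        this value of t makes the quadratic form a - (a + 1) = -1.\<close>
      hence "2 * 1 * (- (?a + 1) / (2 * ?b)) * ?b = - (?a + 1)" by simp
      thus False using quad[of 1 "- (?a + 1) / (2 * ?b)"] True by simp
    qed
    thus ?thesis using True by simp
  next
    case False
    \<comment> \<open>At s = c, t = - b the quadratic form equals c (a c - b ^ 2).\<close>
    have "0 \<le> ?c * (?a * ?c - ?b\<^sup>2)"
      using quad[of "?c" "- ?b"] by (simp add: power2_eq_square algebra_simps)
    thus ?thesis using False c0 by (simp add: zero_le_mult_iff)
  qed
qed

section \<open>The Hoelder inequality for the 6-cycle\<close>

text \<open>A path of three edges in a bipartite graph traverses its middle edge from right to left,
  hence the transpose.\<close>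

definition path_kernel :: "('a \<times> 'a \<Rightarrow> real) \<Rightarrow> ('a \<times> 'a \<Rightarrow> real) \<Rightarrow> ('a \<times> 'a \<Rightarrow> real) \<Rightarrow> 'a \<times> 'a \<Rightarrow> real" where
  "path_kernel a b c = a \<odot> b\<^sup>t \<odot> c"

text \<open>Two copies of the path glued at both ends form the 6-cycle.\<close>

definition schatten6 :: "('a \<times> 'a \<Rightarrow> real) \<Rightarrow> real" where
  "schatten6 a = kernel_inner (path_kernel a a a) (path_kernel a a a)"

lemma path_kernel_bounded [simp]:
  "a \<in> bounded_kernels \<Longrightarrow> b \<in> bounded_kernels \<Longrightarrow> c \<in> bounded_kernels \<Longrightarrow>
    path_kernel a b c \<in> bounded_kernels"
  by (simp add: path_kernel_def)

text \<open>
  The next three lemmas are Cauchy--Schwarz inequalities for the cyclic words \<open>abccba\<close>, \<open>ccbbcc\<close>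
  and \<open>baaaab\<close> of kernels on the 6-cycle, each cut at a pair of opposite vertices.
\<close>

lemma path_kernel_split:
  assumes a: "a \<in> bounded_kernels" and b: "b \<in> bounded_kernels" and c: "c \<in> bounded_kernels"
  shows "(kernel_inner (path_kernel a b c) (path_kernel a b c))\<^sup>2 \<le>
    kernel_inner (path_kernel b a a) (path_kernel b a a) * kernel_inner (path_kernel c c b) (path_kernel c c b)"
proof -
  let ?x = "a\<^sup>t \<odot> a \<odot> b\<^sup>t" and ?y = "b\<^sup>t \<odot> c \<odot> c\<^sup>t"
  have "kernel_inner (path_kernel a b c) (path_kernel a b c)
      = kernel_inner (a \<odot> (b\<^sup>t \<odot> c)) (a \<odot> (b\<^sup>t \<odot> c))"
    using assms by (simp add: path_kernel_def kernel_comp_assoc)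
  also have "\<dots> = kernel_inner (b\<^sup>t \<odot> c) (a\<^sup>t \<odot> (a \<odot> (b\<^sup>t \<odot> c)))"
    using assms by (intro kernel_inner_comp_right) auto
  also have "\<dots> = kernel_inner (?x \<odot> c) (b\<^sup>t \<odot> c)"
    using assms by (simp add: kernel_comp_assoc kernel_inner_commute)
  also have "\<dots> = kernel_inner ?x ?y"
    using assms by (intro kernel_inner_comp_left) auto
  finally have "(kernel_inner (path_kernel a b c) (path_kernel a b c))\<^sup>2 \<le> kernel_inner ?x ?x * kernel_inner ?y ?y"
    using kernel_inner_Cauchy_Schwarz[of ?x ?y] assms by simp
  also have "kernel_inner ?x ?x = kernel_inner (path_kernel b a a) (path_kernel b a a)"
    using kernel_inner_transpose[of ?x ?x] assms
    by (simp add: path_kernel_def transpose_comp kernel_comp_assoc)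
  also have "kernel_inner ?y ?y = kernel_inner (path_kernel c c b) (path_kernel c c b)"
    using kernel_inner_transpose[of ?y ?y] assms
    by (simp add: path_kernel_def transpose_comp kernel_comp_assoc)
  finally show ?thesis .
qed

lemma path_kernel_left_pair:
  assumes b: "b \<in> bounded_kernels" and c: "c \<in> bounded_kernels"
  shows "(kernel_inner (path_kernel c c b) (path_kernel c c b))\<^sup>2 \<le>
    schatten6 c * kernel_inner (path_kernel b b c) (path_kernel b b c)"
proof -
  let ?x = "path_kernel b b c" and ?y = "path_kernel c c c"
  let ?c = "c \<odot> c\<^sup>t"
  have "kernel_inner ?x ?y = kernel_inner (b \<odot> b\<^sup>t) (?y \<odot> c\<^sup>t)"
    unfolding path_kernel_def using assms by (intro kernel_inner_comp_left) auto
  also have "\<dots> = kernel_inner (b\<^sup>t) (b\<^sup>t \<odot> (?y \<odot> c\<^sup>t))"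
    using assms by (intro kernel_inner_comp_right) auto
  also have "\<dots> = kernel_inner (b\<^sup>t \<odot> ?c \<odot> ?c) (b\<^sup>t)"
    using assms by (simp add: path_kernel_def kernel_comp_assoc kernel_inner_commute)
  also have "\<dots> = kernel_inner (b\<^sup>t \<odot> ?c) (b\<^sup>t \<odot> ?c\<^sup>t)"
    using assms by (intro kernel_inner_comp_left) auto
  also have "\<dots> = kernel_inner (path_kernel c c b) (path_kernel c c b)"
    using kernel_inner_transpose[of "b\<^sup>t \<odot> ?c" "b\<^sup>t \<odot> ?c"] assms
    by (simp add: path_kernel_def transpose_comp)
  finally show ?thesis
    using kernel_inner_Cauchy_Schwarz[of ?x ?y] assms by (simp add: schatten6_def mult.commute)
qed

lemma path_kernel_right_pair:
  assumes a: "a \<in> bounded_kernels" and b: "b \<in> bounded_kernels"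
  shows "(kernel_inner (path_kernel b a a) (path_kernel b a a))\<^sup>2 \<le>
    schatten6 a * kernel_inner (path_kernel a b b) (path_kernel a b b)"
proof -
  let ?x = "path_kernel a a a" and ?y = "path_kernel a b b"
  let ?a = "a\<^sup>t \<odot> a"
  have "kernel_inner ?x ?y = kernel_inner (a \<odot> ?a) (a \<odot> (b\<^sup>t \<odot> b))"
    using assms by (simp add: path_kernel_def kernel_comp_assoc)
  also have "\<dots> = kernel_inner ?a (a\<^sup>t \<odot> (a \<odot> (b\<^sup>t \<odot> b)))"
    using assms by (intro kernel_inner_comp_right) auto
  also have "\<dots> = kernel_inner (?a \<odot> b\<^sup>t \<odot> b) ?a"
    using assms by (simp add: kernel_comp_assoc kernel_inner_commute)
  also have "\<dots> = kernel_inner (?a \<odot> b\<^sup>t) (?a \<odot> b\<^sup>t)"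
    using assms by (intro kernel_inner_comp_left) auto
  also have "\<dots> = kernel_inner (path_kernel b a a) (path_kernel b a a)"
    using kernel_inner_transpose[of "?a \<odot> b\<^sup>t" "?a \<odot> b\<^sup>t"] assms
    by (simp add: path_kernel_def transpose_comp kernel_comp_assoc)
  finally show ?thesis
    using kernel_inner_Cauchy_Schwarz[of ?x ?y] assms by (simp add: schatten6_def)
qed

text \<open>Eliminating \<open>q\<close> gives p ^ 4 \<le> x ^ 2 q ^ 2 \<le> x ^ 2 y p. It serves
  for a word in two kernels and the word with these exchanged, each bounding the square of the
  other.\<close>

lemma cube_le_of_mutual_squares:
  fixes p q x y :: real
  assumes "p\<^sup>2 \<le> x * q" "q\<^sup>2 \<le> y * p" "0 \<le> p" "0 \<le> q" "0 \<le> x" "0 \<le> y"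
  shows "p ^ 3 \<le> x\<^sup>2 * y"
proof (cases "p = 0")
  case False
  have "p * p ^ 3 = (p\<^sup>2)\<^sup>2" by (simp add: power2_eq_square power3_eq_cube)
  also have "\<dots> \<le> (x * q)\<^sup>2" using assms by (intro power_mono) auto
  also have "\<dots> = x\<^sup>2 * q\<^sup>2" by (simp add: power_mult_distrib)
  also have "\<dots> \<le> x\<^sup>2 * (y * p)" using assms by (intro mult_left_mono) auto
  finally have "p * p ^ 3 \<le> p * (x\<^sup>2 * y)" by (simp add: mult_ac)
  thus ?thesis using False assms by simp
qed (use assms in simp)

lemma schatten6_nonneg: "0 \<le> schatten6 a"
  by (simp add: schatten6_def kernel_inner_nonneg)

text \<open>\<open>path_kernel_split\<close> reduces three kernels to words in two, and
  \<open>cube_le_of_mutual_squares\<close> bounds those by \<open>schatten6\<close>. The resulting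
  product is a perfect square, whose root is the claim.\<close>

lemma path_kernel_norm_le:
  assumes a: "a \<in> bounded_kernels" and b: "b \<in> bounded_kernels" and c: "c \<in> bounded_kernels"
  shows "kernel_inner (path_kernel a b c) (path_kernel a b c) ^ 3 \<le> schatten6 a * schatten6 b * schatten6 c"
proof -
  define \<Phi> where "\<Phi> a b c = kernel_inner (path_kernel a b c) (path_kernel a b c)" for a b c
  have nn: "0 \<le> \<Phi> a b c" for a b c by (simp add: \<Phi>_def kernel_inner_nonneg)
  note s = schatten6_nonneg
  have 1: "\<Phi> c c b ^ 3 \<le> (schatten6 c)\<^sup>2 * schatten6 b"
    by (rule cube_le_of_mutual_squares[of _ _ "\<Phi> b b c"])
      (use path_kernel_left_pair[OF b c] path_kernel_left_pair[OF c b] nn s in \<open>auto simp: \<Phi>_def\<close>)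
  have 2: "\<Phi> b a a ^ 3 \<le> (schatten6 a)\<^sup>2 * schatten6 b"
    by (rule cube_le_of_mutual_squares[of _ _ "\<Phi> a b b"])
      (use path_kernel_right_pair[OF b a] path_kernel_right_pair[OF a b] nn s in \<open>auto simp: \<Phi>_def\<close>)
  have "(\<Phi> a b c ^ 3)\<^sup>2 = ((\<Phi> a b c)\<^sup>2) ^ 3" by (simp add: power_mult[symmetric])
  also have "\<dots> \<le> (\<Phi> b a a * \<Phi> c c b) ^ 3"
    using path_kernel_split[OF a b c] by (intro power_mono) (auto simp: \<Phi>_def)
  also have "\<dots> = \<Phi> b a a ^ 3 * \<Phi> c c b ^ 3" by (simp add: power_mult_distrib)
  also have "\<dots> \<le> ((schatten6 a)\<^sup>2 * schatten6 b) * ((schatten6 c)\<^sup>2 * schatten6 b)"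
    using 1 2 nn s by (intro mult_mono) auto
  also have "\<dots> = (schatten6 a * schatten6 b * schatten6 c)\<^sup>2"
    by (simp add: power2_eq_square mult_ac)
  finally have "(\<Phi> a b c ^ 3)\<^sup>2 \<le> (schatten6 a * schatten6 b * schatten6 c)\<^sup>2" .
  hence "\<Phi> a b c ^ 3 \<le> schatten6 a * schatten6 b * schatten6 c"
    using s by (intro power2_le_imp_le[of "\<Phi> a b c ^ 3"]) auto
  thus ?thesis by (simp add: \<Phi>_def)
qed

text \<open>Cauchy--Schwarz separates the two halves of the cycle, and
  \<open>path_kernel_norm_le\<close> bounds each half.\<close>

lemma six_cycle_Hoelder:
  assumes f: "f1 \<in> bounded_kernels" "f2 \<in> bounded_kernels" "f3 \<in> bounded_kernels"
    and g: "g1 \<in> bounded_kernels" "g2 \<in> bounded_kernels" "g3 \<in> bounded_kernels"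
  shows "kernel_inner (path_kernel f1 f2 f3) (path_kernel g1 g2 g3) ^ 6 \<le>
    (schatten6 f1 * schatten6 f2 * schatten6 f3) * (schatten6 g1 * schatten6 g2 * schatten6 g3)"
proof -
  let ?f = "path_kernel f1 f2 f3" and ?g = "path_kernel g1 g2 g3"
  have "kernel_inner ?f ?g ^ 6 = ((kernel_inner ?f ?g)\<^sup>2) ^ 3" by (simp add: power_mult[symmetric])
  also have "\<dots> \<le> (kernel_inner ?f ?f * kernel_inner ?g ?g) ^ 3"
    using assms by (intro power_mono kernel_inner_Cauchy_Schwarz) auto
  also have "\<dots> = kernel_inner ?f ?f ^ 3 * kernel_inner ?g ?g ^ 3" by (simp add: power_mult_distrib)
  also have "\<dots> \<le> (schatten6 f1 * schatten6 f2 * schatten6 f3) * (schatten6 g1 * schatten6 g2 * schatten6 g3)"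
    using assms kernel_inner_nonneg schatten6_nonneg
    by (intro mult_mono path_kernel_norm_le) auto
  finally show ?thesis .
qed

section \<open>The triangle inequality\<close>

lemma kernel_comp_add_left:
  assumes f: "f \<in> bounded_kernels" and g: "g \<in> bounded_kernels" and h: "h \<in> bounded_kernels"
  shows "(\<lambda>z. f z + g z) \<odot> h = (\<lambda>z. (f \<odot> h) z + (g \<odot> h) z)"
proof (rule ext, clarify)
  fix u w
  have int: "integrable M (\<lambda>v. k (u, v) * h (v, w))" if k: "k \<in> bounded_kernels" for k
  proof -
    obtain B where B: "\<And>z. \<bar>k z\<bar> \<le> B" using bounded_kernelsD(2)[OF k] by blast
    obtain C where C: "\<And>z. \<bar>h z\<bar> \<le> C" using bounded_kernelsD(2)[OF h] by blast
    have "\<bar>k (u, v) * h (v, w)\<bar> \<le> B * C" for v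
      unfolding abs_mult using B[of "(u, v)"] C[of "(v, w)"] by (intro mult_mono) auto
    thus ?thesis using measurable_kernel_section[OF k] measurable_kernel_section[OF h]
      by (intro integrable_bounded) auto
  qed
  show "((\<lambda>z. f z + g z) \<odot> h) (u, w) = (f \<odot> h) (u, w) + (g \<odot> h) (u, w)"
    using int[OF f] int[OF g] by (simp add: kernel_comp_def distrib_right)
qed

lemma path_kernel_add:
  assumes "f \<in> bounded_kernels" "g \<in> bounded_kernels" "b \<in> bounded_kernels" "c \<in> bounded_kernels"
  shows "path_kernel (\<lambda>z. f z + g z) b c = (\<lambda>z. path_kernel f b c z + path_kernel g b c z)"
  using assms by (simp add: path_kernel_def kernel_comp_add_left)

text \<open>Minkowski's argument: one of the six copies of h = f + g is expanded, Hoelder bounds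
  both terms, and the fifth power of the norm of \<open>h\<close> cancels.\<close>

lemma schatten6_triangle:
  assumes f: "f \<in> bounded_kernels" and g: "g \<in> bounded_kernels"
  shows "root 6 (schatten6 (\<lambda>z. f z + g z)) \<le> root 6 (schatten6 f) + root 6 (schatten6 g)"
proof -
  define h where "h = (\<lambda>z. f z + g z)"
  have h: "h \<in> bounded_kernels" using f g by (simp add: h_def)
  define N where "N k = root 6 (schatten6 k)" for k
  have N: "0 \<le> N k" "N k ^ 6 = schatten6 k" for k
    by (simp_all add: N_def schatten6_nonneg)
  have le: "kernel_inner (path_kernel k h h) (path_kernel h h h) \<le> N k * N h ^ 5"
    if k: "k \<in> bounded_kernels" for k
  proof (rule power_le_imp_le_base)
    have "kernel_inner (path_kernel k h h) (path_kernel h h h) ^ 6 \<le>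
      (schatten6 k * schatten6 h * schatten6 h) * (schatten6 h * schatten6 h * schatten6 h)"
      by (rule six_cycle_Hoelder) (use k h in auto)
    also have "\<dots> = (N k * N h ^ 5) ^ 6"
      by (simp add: N(2)[symmetric] power_mult_distrib flip: power_mult power_add)
    finally show "kernel_inner (path_kernel k h h) (path_kernel h h h) ^ Suc 5 \<le> (N k * N h ^ 5) ^ Suc 5"
      by simp
    show "0 \<le> N k * N h ^ 5" using N by simp
  qed
  have "N h * N h ^ 5 = schatten6 h" using N(2)[of h] by (simp flip: power_Suc)
  also have "\<dots> = kernel_inner (path_kernel f h h) (path_kernel h h h)
      + kernel_inner (path_kernel g h h) (path_kernel h h h)"
    using path_kernel_add[OF f g h h] kernel_inner_add[of "path_kernel f h h" "path_kernel g h h" "path_kernel h h h"]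
      f g h by (simp add: schatten6_def h_def)
  also have "\<dots> \<le> (N f + N g) * N h ^ 5" using le[OF f] le[OF g] by (simp add: distrib_right)
  finally have *: "N h * N h ^ 5 \<le> (N f + N g) * N h ^ 5" .
  show ?thesis
  proof (cases "N h = 0")
    case True
    thus ?thesis using N(1)[of f] N(1)[of g] unfolding N_def h_def by linarith
  next
    case False
    hence "0 < N h ^ 5" using N(1)[of h] by simp
    hence "N h \<le> N f + N g" using * by simp
    thus ?thesis by (simp add: N_def h_def)
  qed
qed

section \<open>Definiteness\<close>

lemma indicator_bounded_kernel:
  assumes "A \<in> sets M" "B \<in> sets M"
  shows "indicator (A \<times> B) \<in> bounded_kernels"
proof -
  have "A \<subseteq> space M" "B \<subseteq> space M" using assms sets.sets_into_space by auto
  moreover have "A \<times> B \<in> sets (M \<Otimes>\<^sub>M M)" using assms by simp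
  ultimately show ?thesis
    by (intro bounded_kernelsI[of _ 1]) (auto simp: indicator_def)
qed

text \<open>With \<open>f\<close> on one edge of the cycle and indicators on the other five, the
  cycle integral is the integral of \<open>f\<close> over the rectangle: \<open>gA\<close> and
  \<open>gB\<close> confine the two ends of that edge, and \<open>one\<close> leaves the rest free.
  Hoelder forces it to be 0.\<close>

lemma schatten6_eq_0_integral_Times:
  assumes f: "f \<in> bounded_kernels" and 0: "schatten6 f = 0" and A: "A \<in> sets M" and B: "B \<in> sets M"
  shows "(\<integral>z. f z * indicator (A \<times> B) z \<partial>(M \<Otimes>\<^sub>M M)) = 0"
proof -
  define one gA gB :: "'a \<times> 'a \<Rightarrow> real"
    where "one = indicator (space M \<times> space M)" and "gA = indicator (A \<times> space M)"
      and "gB = indicator (space M \<times> B)"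
  have g: "one \<in> bounded_kernels" "gA \<in> bounded_kernels" "gB \<in> bounded_kernels"
    using A B by (auto simp: one_def gA_def gB_def intro!: indicator_bounded_kernel)
  have "kernel_inner (path_kernel f gB one) (path_kernel gA one one) ^ 6 \<le> 0"
    using six_cycle_Hoelder[OF f g(3,1,2,1,1)] 0 by simp
  hence "kernel_inner (path_kernel f gB one) (path_kernel gA one one) = 0"
    using zero_le_power_eq_numeral[of "kernel_inner (path_kernel f gB one) (path_kernel gA one one)"]
    by (metis even_numeral linorder_not_less order_antisym power_eq_0_iff zero_le_even_power)
  moreover have "path_kernel f gB one (u, w) = (\<integral>v. f (u, v) * indicator B v \<partial>M)"
    if "u \<in> space M" "w \<in> space M" for u w
  proof -
    have "(f \<odot> gB\<^sup>t) (u, x) = (\<integral>v. f (u, v) * indicator B v \<partial>M)" if "x \<in> space M" for x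
      unfolding kernel_comp_def using that
      by (auto intro!: Bochner_Integration.integral_cong simp: gB_def indicator_def)
    hence "(f \<odot> gB\<^sup>t \<odot> one) (u, w) = (\<integral>x. (\<integral>v. f (u, v) * indicator B v \<partial>M) \<partial>M)"
      unfolding kernel_comp_def[of _ one] prod.case using that
      by (intro Bochner_Integration.integral_cong) (auto simp: one_def indicator_def)
    thus ?thesis by (simp add: path_kernel_def prob_space)
  qed
  moreover have "path_kernel gA one one (u, w) = indicator A u"
    if "u \<in> space M" "w \<in> space M" for u w
  proof -
    have "(gA \<odot> one\<^sup>t) (u, x) = (\<integral>v. indicator A u \<partial>M)" if "x \<in> space M" for x
      unfolding kernel_comp_def prod.case using that \<open>u \<in> space M\<close>
      by (intro Bochner_Integration.integral_cong) (auto simp: gA_def one_def indicator_def)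
    hence "(gA \<odot> one\<^sup>t \<odot> one) (u, w) = (\<integral>x. indicator A u \<partial>M)"
      unfolding kernel_comp_def[of _ one] prod.case using that
      by (intro Bochner_Integration.integral_cong) (auto simp: one_def indicator_def prob_space)
    thus ?thesis by (simp add: path_kernel_def prob_space)
  qed
  ultimately have "(\<integral>u. \<integral>w. (\<integral>v. f (u, v) * indicator B v \<partial>M) * indicator A u \<partial>M \<partial>M) = 0"
    unfolding kernel_inner_def by (simp cong: Bochner_Integration.integral_cong)
  hence "(\<integral>u. \<integral>v. f (u, v) * indicator (A \<times> B) (u, v) \<partial>M \<partial>M) = 0"
    by (simp add: prob_space indicator_times mult_ac)
  thus ?thesis
    using kernel_inner_eq(2)[OF f indicator_bounded_kernel[OF A B]] by (simp add: kernel_inner_def)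
qed

text \<open>The rectangles form a generator closed under intersection, so a Dynkin argument makes
  the integral of \<open>f\<close> vanish over every measurable set. Uniqueness of densities then
  gives f = 0 almost everywhere.\<close>

lemma schatten6_eq_0:
  assumes f: "f \<in> bounded_kernels" and 0: "schatten6 f = 0"
  shows "AE z in M \<Otimes>\<^sub>M M. f z = 0"
proof -
  interpret pair_prob_space M M by (rule pair_prob)
  obtain B where B: "\<And>z. \<bar>f z\<bar> \<le> B" using bounded_kernelsD(2)[OF f] by blast
  note [measurable] = bounded_kernelsD(1)[OF f]
  have int: "integrable (M \<Otimes>\<^sub>M M) f"
    using B by (intro P.integrable_const_bound[of _ B]) auto
  have sint: "set_integrable (M \<Otimes>\<^sub>M M) S f" if "S \<in> sets (M \<Otimes>\<^sub>M M)" for S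
    unfolding set_integrable_def using integrable_mult_indicator[OF that int] .
  have zero: "set_lebesgue_integral (M \<Otimes>\<^sub>M M) S f = 0" if S: "S \<in> sets (M \<Otimes>\<^sub>M M)" for S
    using Int_stable_pair_measure_generator pair_measure_closed S unfolding sets_pair_measure
  proof (induction rule: sigma_sets_induct_disjoint)
    case (basic S)
    then obtain A1 A2 where "S = A1 \<times> A2" "A1 \<in> sets M" "A2 \<in> sets M" by auto
    thus ?case using schatten6_eq_0_integral_Times[OF f 0]
      by (simp add: set_lebesgue_integral_def mult.commute)
  next
    case empty
    show ?case by (simp add: set_lebesgue_integral_def)
  next
    case (compl S)
    hence S: "S \<in> sets (M \<Otimes>\<^sub>M M)" by (simp add: sets_pair_measure)
    have top: "set_lebesgue_integral (M \<Otimes>\<^sub>M M) (space M \<times> space M) f = 0"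
      using schatten6_eq_0_integral_Times[OF f 0, of "space M" "space M"]
      by (simp add: set_lebesgue_integral_def mult.commute)
    have "set_lebesgue_integral (M \<Otimes>\<^sub>M M) (S \<union> (space M \<times> space M - S)) f =
      set_lebesgue_integral (M \<Otimes>\<^sub>M M) S f + set_lebesgue_integral (M \<Otimes>\<^sub>M M) (space M \<times> space M - S) f"
    proof (intro set_integral_Un sint S)
      show "space M \<times> space M - S \<in> sets (M \<Otimes>\<^sub>M M)"
        using sets.compl_sets[OF S] by (simp add: space_pair_measure)
    qed auto
    moreover have "S \<union> (space M \<times> space M - S) = space M \<times> space M"
      using sets.sets_into_space[OF S] by (auto simp: space_pair_measure)
    ultimately show ?case using compl top by simp
  next
    case (union S)
    hence S: "S i \<in> sets (M \<Otimes>\<^sub>M M)" for i by (auto simp: sets_pair_measure)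
    have "set_lebesgue_integral (M \<Otimes>\<^sub>M M) (\<Union>i. S i) f = (\<Sum>i. set_lebesgue_integral (M \<Otimes>\<^sub>M M) (S i) f)"
      using union(1) S
      by (intro lebesgue_integral_countable_add sint) (auto simp: disjoint_family_on_def)
    thus ?case using union by simp
  qed
  show ?thesis
    using density_unique_real[OF int, of "\<lambda>_. 0"] zero by (simp add: set_lebesgue_integral_def)
qed

section \<open>The density of the 6-cycle as an iterated integral\<close>

text \<open>Joining the two edges at each right vertex turns the 6-cycle of \<open>f\<close> into a
  triangle of \<open>f \<odot> f\<^sup>t\<close>, the form in which
  \<open>six_cycle_integral\<close> arrives at it.\<close>

lemma schatten6_eq_triangle:
  assumes f: "f \<in> bounded_kernels"
  shows "schatten6 f = kernel_inner (f \<odot> f\<^sup>t) (f \<odot> f\<^sup>t \<odot> (f \<odot> f\<^sup>t))"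
proof -
  have "schatten6 f = kernel_inner (f \<odot> f\<^sup>t) (path_kernel f f f \<odot> f\<^sup>t)"
    unfolding schatten6_def path_kernel_def using f by (intro kernel_inner_comp_left) auto
  thus ?thesis using f by (simp add: path_kernel_def kernel_comp_assoc)
qed

text \<open>For fixed left variables the right variables separate, and each integrates to the value
  of \<open>G\<close> at its two neighbours. The remaining triangle in \<open>G\<close> is
  integrated one variable at a time.\<close>

lemma six_cycle_integral:
  fixes a b c :: 'i and x y z :: 'j
  assumes f: "f \<in> bounded_kernels" and abc: "distinct [a, b, c]" and xyz: "distinct [x, y, z]"
  shows "(\<integral>(s, t). f (s a, t x) * f (s b, t x) * (f (s a, t y) * f (s c, t y)) * (f (s b, t z) * f (s c, t z))
    \<partial>((\<Pi>\<^sub>M i\<in>{a, b, c}. M) \<Otimes>\<^sub>M (\<Pi>\<^sub>M j\<in>{x, y, z}. M))) = schatten6 f"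
proof -
  let ?P = "\<Pi>\<^sub>M i\<in>{a, b, c}. M" and ?Q = "\<Pi>\<^sub>M j\<in>{x, y, z}. M"
  interpret S: product_sigma_finite "\<lambda>_. M" ..
  interpret P: prob_space ?P by (intro prob_space_PiM prob_space_axioms)
  interpret Q: prob_space ?Q by (intro prob_space_PiM prob_space_axioms)
  interpret PQ: pair_prob_space ?P ?Q ..
  define G where "G = f \<odot> f\<^sup>t"
  have G: "G \<in> bounded_kernels" using f by (simp add: G_def)
  have Gt: "G\<^sup>t = G" by (simp add: G_def transpose_comp)
  obtain B where B: "\<And>z. \<bar>f z\<bar> \<le> B" using bounded_kernelsD(2)[OF f] by blast
  have B0: "0 \<le> B" using B[of undefined] by simp
  note [measurable] = bounded_kernelsD(1)[OF f] bounded_kernelsD(1)[OF G]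
  let ?F = "\<lambda>(s, t). f (s a, t x) * f (s b, t x) * (f (s a, t y) * f (s c, t y)) * (f (s b, t z) * f (s c, t z))"
  have bound: "\<bar>p * q * (p' * q') * (p'' * q'')\<bar> \<le> B * B * (B * B) * (B * B)"
    if "\<bar>p\<bar> \<le> B" "\<bar>q\<bar> \<le> B" "\<bar>p'\<bar> \<le> B" "\<bar>q'\<bar> \<le> B" "\<bar>p''\<bar> \<le> B" "\<bar>q''\<bar> \<le> B" for p q p' q' p'' q''
    unfolding abs_mult using that B0 by (intro mult_mono mult_nonneg_nonneg) auto
  have "?F \<in> borel_measurable (?P \<Otimes>\<^sub>M ?Q)" by measurable
  hence int: "integrable (?P \<Otimes>\<^sub>M ?Q) ?F"
    by (intro PQ.P.integrable_const_bound[of _ "B * B * (B * B) * (B * B)"])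
      (auto intro!: AE_I2 bound B simp: split_beta)
  have "(\<integral>p. ?F p \<partial>(?P \<Otimes>\<^sub>M ?Q)) = (\<integral>s. \<integral>t. ?F (s, t) \<partial>?Q \<partial>?P)"
    using PQ.integral_fst'[OF int] by simp
  also have "\<dots> = (\<integral>s. G (s a, s b) * G (s a, s c) * G (s b, s c) \<partial>?P)"
  proof (intro Bochner_Integration.integral_cong refl)
    fix s assume "s \<in> space ?P"
    \<comment> \<open>\<open>h j\<close> collects the two edges at the right vertex
      \<open>j\<close>, which makes the integrand a product over coordinates.\<close>
    define h where "h j v = (if j = x then f (s a, v) * f (s b, v) else if j = y then f (s a, v) * f (s c, v)
      else f (s b, v) * f (s c, v))" for j v
    have pair: "integrable M (\<lambda>v. f (u, v) * f (w, v))" for u w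
    proof (rule integrable_bounded)
      show "\<bar>f (u, v) * f (w, v)\<bar> \<le> B * B" for v
        unfolding abs_mult using B B0 by (intro mult_mono) auto
    qed (use measurable_kernel_section[OF f] in measurable)
    have "(\<integral>t. ?F (s, t) \<partial>?Q) = (\<integral>t. (\<Prod>j\<in>{x, y, z}. h j (t j)) \<partial>?Q)"
      using xyz by (intro Bochner_Integration.integral_cong refl) (auto simp: h_def mult_ac)
    also have "\<dots> = (\<Prod>j\<in>{x, y, z}. \<integral>v. h j v \<partial>M)"
    proof (rule S.product_integral_prod)
      show "integrable M (h j)" for j
        using pair unfolding h_def by (cases "j = x"; cases "j = y") simp_all
    qed simp
    also have "\<dots> = G (s a, s b) * G (s a, s c) * G (s b, s c)"
      using xyz by (auto simp: h_def G_def kernel_comp_def)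
    finally show "(\<integral>t. ?F (s, t) \<partial>?Q) = G (s a, s b) * G (s a, s c) * G (s b, s c)" .
  qed
  also have "\<dots> = (\<integral>s. (G \<odot> G) (s b, s c) * G (s b, s c) \<partial>(\<Pi>\<^sub>M i\<in>{b, c}. M))"
  proof -
    obtain C where C: "\<And>z. \<bar>G z\<bar> \<le> C" using bounded_kernelsD(2)[OF G] by blast
    have C0: "0 \<le> C" using C[of undefined] by simp
    have "(\<lambda>s. G (s a, s b) * G (s a, s c) * G (s b, s c)) \<in> borel_measurable ?P" by measurable
    moreover have "\<bar>G p * G q * G r\<bar> \<le> C * C * C" for p q r
      unfolding abs_mult using C C0 by (intro mult_mono mult_nonneg_nonneg) auto
    ultimately have "integrable ?P (\<lambda>s. G (s a, s b) * G (s a, s c) * G (s b, s c))"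
      by (intro P.integrable_const_bound[of _ "C * C * C"]) auto
    from S.product_integral_insert[OF _ _ this]
    have "(\<integral>s. G (s a, s b) * G (s a, s c) * G (s b, s c) \<partial>?P)
      = (\<integral>s. \<integral>v. G (v, s b) * G (v, s c) * G (s b, s c) \<partial>M \<partial>(\<Pi>\<^sub>M i\<in>{b, c}. M))"
      using abc by auto
    \<comment> \<open>Symmetry of \<open>G\<close> turns the two edges at the integrated vertex into
      a path, hence into \<open>G \<odot> G\<close>.\<close>
    moreover have "(\<integral>v. G (v, u) * G (v, w) * G (u, w) \<partial>M) = (G \<odot> G) (u, w) * G (u, w)" for u w
    proof -
      have "G (v, u) = G (u, v)" for v using fun_cong[OF Gt, of "(u, v)"] by simp
      thus ?thesis by (simp add: kernel_comp_def)
    qed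
    ultimately show ?thesis by (simp only:)
  qed
  also have "\<dots> = (\<integral>w. \<integral>u. (G \<odot> G) (u, w) * G (u, w) \<partial>M \<partial>M)"
  proof -
    let ?K = "\<lambda>z. (G \<odot> G) z * G z"
    have GG: "G \<odot> G \<in> bounded_kernels" using G by simp
    obtain C where C: "\<And>z. \<bar>G z\<bar> \<le> C" using bounded_kernelsD(2)[OF G] by blast
    obtain D where D: "\<And>z. \<bar>(G \<odot> G) z\<bar> \<le> D" using bounded_kernelsD(2)[OF GG] by blast
    have D0: "0 \<le> D" using D[of undefined] by simp
    have KD: "\<bar>?K z\<bar> \<le> D * C" for z
      unfolding abs_mult using C D D0 by (intro mult_mono) auto
    note [measurable] = bounded_kernelsD(1)[OF GG]
    interpret R: prob_space "\<Pi>\<^sub>M i\<in>{b, c}. M" by (intro prob_space_PiM prob_space_axioms)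
    have "(\<lambda>s. ?K (s b, s c)) \<in> borel_measurable (\<Pi>\<^sub>M i\<in>{b, c}. M)" by measurable
    hence "integrable (\<Pi>\<^sub>M i\<in>{b, c}. M) (\<lambda>s. ?K (s b, s c))"
      using KD by (intro R.integrable_const_bound[of _ "D * C"]) auto
    from S.product_integral_insert[OF _ _ this]
    have "(\<integral>s. ?K (s b, s c) \<partial>(\<Pi>\<^sub>M i\<in>{b, c}. M)) = (\<integral>s. \<integral>u. ?K (u, s c) \<partial>M \<partial>(\<Pi>\<^sub>M i\<in>{c}. M))"
      using abc by auto
    also have "\<dots> = (\<integral>w. \<integral>u. ?K (u, w) \<partial>M \<partial>M)"
      by (rule S.product_integral_singleton) measurable
    finally show ?thesis .
  qed
  also have "\<dots> = kernel_inner (G \<odot> G) G"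
    using kernel_inner_transpose[of "G \<odot> G" G] G by (simp add: kernel_inner_def)
  also have "\<dots> = schatten6 f"
    unfolding schatten6_eq_triangle[OF f] G_def[symmetric] by (rule kernel_inner_commute)
  finally show ?thesis .
qed

lemma schatten6_mult:
  "schatten6 (\<lambda>z. k * f z) = k ^ 6 * schatten6 f"
proof -
  have "path_kernel (\<lambda>z. k * f z) (\<lambda>z. k * f z) (\<lambda>z. k * f z) = (\<lambda>z. k ^ 3 * path_kernel f f f z)"
    by (auto simp: path_kernel_def kernel_comp_def kernel_transpose_def power3_eq_cube mult_ac
        simp flip: integral_mult_right_zero)
  hence "schatten6 (\<lambda>z. k * f z) = k ^ 3 * (k ^ 3 * schatten6 f)"
    by (simp add: schatten6_def kernel_inner_mult kernel_inner_commute[of _ "\<lambda>z. k ^ 3 * path_kernel f f f z"])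
  thus ?thesis by (simp flip: power_add mult.assoc)
qed

end

section \<open>The graph H(3, 1)\<close>

lemma kneser_3_1_parts:
  "left_part (bipartite_kneser 3 1) = {{1, 2}, {1, 3}, {2, 3}}"
  "right_part (bipartite_kneser 3 1) = {{1}, {2}, {3}}"
  "edges (bipartite_kneser 3 1) = {({1, 2}, {1}), ({1, 3}, {1}), ({1, 2}, {2}), ({2, 3}, {2}), ({1, 3}, {3}), ({2, 3}, {3})}"
proof -
  have 3: "{1..3::nat} = {1, 2, 3}" by auto
  have two: "X \<subseteq> {1, 2, 3} \<and> card X = 2 \<longleftrightarrow> X \<in> {{1, 2}, {1, 3}, {2, 3}}" for X :: "nat set"
  proof
    assume X: "X \<subseteq> {1, 2, 3} \<and> card X = 2"
    then obtain x y where "X = {x, y}" "x \<noteq> y" by (meson card_2_iff)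
    with X show "X \<in> {{1, 2}, {1, 3}, {2, 3}}" by (auto simp: insert_commute)
  qed auto
  have one: "Y \<subseteq> {1, 2, 3} \<and> card Y = 1 \<longleftrightarrow> Y \<in> {{1}, {2}, {3}}" for Y :: "nat set"
    by (auto simp: card_1_singleton_iff)
  show "left_part (bipartite_kneser 3 1) = {{1, 2}, {1, 3}, {2, 3}}"
    unfolding bipartite_kneser_simps 3 using two by auto
  show "right_part (bipartite_kneser 3 1) = {{1}, {2}, {3}}"
    unfolding bipartite_kneser_simps 3 using one by auto
  have edge: "(X, Y) \<in> edges (bipartite_kneser 3 1) \<longleftrightarrow>
      X \<in> {{1, 2}, {1, 3}, {2, 3}} \<and> Y \<in> {{1}, {2}, {3}} \<and> Y \<subseteq> X" for X Y
    unfolding bipartite_kneser_simps 3 two[symmetric] one[symmetric] by (simp only: conj_assoc) simp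
  show "edges (bipartite_kneser 3 1) = {({1, 2}, {1}), ({1, 3}, {1}), ({1, 2}, {2}), ({2, 3}, {2}), ({1, 3}, {3}), ({2, 3}, {3})}"
  proof (rule subset_antisym; rule subrelI)
    fix X Y :: "nat set"
    assume "(X, Y) \<in> edges (bipartite_kneser 3 1)"
    hence "X \<in> {{1, 2}, {1, 3}, {2, 3}}" "Y \<in> {{1}, {2}, {3}}" "Y \<subseteq> X" by (simp_all only: edge)
    thus "(X, Y) \<in> {({1, 2}, {1}), ({1, 3}, {1}), ({1, 2}, {2}), ({2, 3}, {2}), ({1, 3}, {3}), ({2, 3}, {3})}"
      by (elim insertE emptyE; simp)
  next
    fix X Y :: "nat set"
    assume "(X, Y) \<in> {({1, 2}, {1}), ({1, 3}, {1}), ({1, 2}, {2}), ({2, 3}, {2}), ({1, 3}, {3}), ({2, 3}, {3})}"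
    thus "(X, Y) \<in> edges (bipartite_kneser 3 1)"
      unfolding edge by (elim insertE emptyE; simp)
  qed
qed

lemma is_cycle_kneser_3_1: "is_cycle 6 (bipartite_kneser 3 1)"
proof -
  \<comment> \<open>The vertices in cyclic order, with 2-sets and singletons alternating.\<close>
  define xs :: "nat set list" where "xs = [{1, 2}, {1}, {1, 3}, {3}, {2, 3}, {2}]"
  have "bij_betw ((!) xs) {..<length xs} (set xs)"
    by (rule bij_betw_nth) (auto simp: xs_def doubleton_eq_iff)
  moreover have "set xs = left_part (bipartite_kneser 3 1) \<union> right_part (bipartite_kneser 3 1)"
    unfolding kneser_3_1_parts xs_def by auto
  moreover have "length xs = 6" by (simp add: xs_def)
  moreover have "adjacent (bipartite_kneser 3 1) (xs ! i) (xs ! j) \<longleftrightarrow> j = Suc i mod 6 \<or> i = Suc j mod 6"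
    if "i < 6" "j < 6" for i j
  proof -
    have "i \<in> {0, 1, 2, 3, 4, 5}" "j \<in> {0, 1, 2, 3, 4, 5}" using that by auto
    thus ?thesis unfolding adjacent_def kneser_3_1_parts xs_def
      by (elim insertE emptyE; simp add: doubleton_eq_iff)
  qed
  moreover have "left_part (bipartite_kneser 3 1) \<inter> right_part (bipartite_kneser 3 1) = {}"
    unfolding kneser_3_1_parts by (auto simp: doubleton_eq_iff)
  ultimately show ?thesis unfolding is_cycle_def by metis
qed

interpretation unit_kernels: kernel_space unit_interval
  by (simp add: kernel_space_def prob_space_unit_interval)

text \<open>Members of \<open>kernels\<close> are arbitrary off the square, whereas
  \<open>bounded_kernels\<close> must vanish there; the density sees only the values on the
  square.\<close>

definition cut_off :: "(real \<times> real \<Rightarrow> real) \<Rightarrow> real \<times> real \<Rightarrow> real" where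
  "cut_off f = (\<lambda>z. f z * indicator ({0..1} \<times> {0..1}) z)"

lemma cut_off_bounded_kernel:
  assumes "f \<in> kernels"
  shows "cut_off f \<in> unit_kernels.bounded_kernels"
proof -
  have [measurable]: "f \<in> borel_measurable unit_square" using assms by (simp add: kernels_def)
  have sp: "{0..1} \<times> {0..1} = space unit_square" by (simp add: space_pair_measure)
  obtain B where B: "\<And>z. z \<in> {0..1} \<times> {0..1} \<Longrightarrow> \<bar>f z\<bar> \<le> B"
    using assms by (auto simp: kernels_def bounded_iff)
  show ?thesis
  proof (rule unit_kernels.bounded_kernelsI)
    show "cut_off f \<in> borel_measurable unit_square"
      unfolding cut_off_def sp by measurable
    show "\<bar>cut_off f z\<bar> \<le> \<bar>B\<bar>" for z
      using B[of z] by (cases "z \<in> {0..1} \<times> {0..1}") (auto simp: cut_off_def)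
  qed (auto simp: cut_off_def)
qed

lemma hom_density_kneser_3_1:
  assumes "f \<in> kernels"
  shows "hom_density (bipartite_kneser 3 1) f = unit_kernels.schatten6 (cut_off f)"
proof -
  let ?P = "\<Pi>\<^sub>M u\<in>{{1, 2}, {1, 3}, {2, 3::nat}}. unit_interval" and ?Q = "\<Pi>\<^sub>M v\<in>{{1}, {2}, {3::nat}}. unit_interval"
  let ?f = "cut_off f"
  have "hom_density (bipartite_kneser 3 1) f = (\<integral>(s, t). ?f (s {1, 2}, t {1}) * ?f (s {1, 3}, t {1}) *
      (?f (s {1, 2}, t {2}) * ?f (s {2, 3}, t {2})) * (?f (s {1, 3}, t {3}) * ?f (s {2, 3}, t {3})) \<partial>(?P \<Otimes>\<^sub>M ?Q))"
    unfolding hom_density_def kneser_3_1_parts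
  proof (intro Bochner_Integration.integral_cong refl, clarify)
    fix s t assume "(s, t) \<in> space (?P \<Otimes>\<^sub>M ?Q)"
    hence "?f (s u, t v) = f (s u, t v)" if "u \<in> {{1, 2}, {1, 3}, {2, 3}}" "v \<in> {{1}, {2}, {3}}" for u v
      using that by (auto simp: cut_off_def space_pair_measure space_PiM PiE_iff)
    thus "(\<Prod>(u, v)\<in>{({1, 2}, {1}), ({1, 3}, {1}), ({1, 2}, {2}), ({2, 3}, {2}), ({1, 3}, {3}), ({2, 3}, {3})}. f (s u, t v))
      = ?f (s {1, 2}, t {1}) * ?f (s {1, 3}, t {1}) * (?f (s {1, 2}, t {2}) * ?f (s {2, 3}, t {2})) *
        (?f (s {1, 3}, t {3}) * ?f (s {2, 3}, t {3}))"
      by (simp add: doubleton_eq_iff mult_ac)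
  qed
  also have "\<dots> = unit_kernels.schatten6 ?f"
    by (rule unit_kernels.six_cycle_integral[OF cut_off_bounded_kernel[OF assms]])
      (auto simp: doubleton_eq_iff)
  finally show ?thesis .
qed

lemma norming_kneser_3_1: "norming (bipartite_kneser 3 1)"
proof -
  let ?H = "bipartite_kneser 3 1" and ?S = "unit_kernels.schatten6"
  have "card (edges ?H) = 6" unfolding kneser_3_1_parts by (simp add: doubleton_eq_iff)
  hence norm: "graph_norm ?H f = root 6 (?S (cut_off f))" if "f \<in> kernels" for f
    using hom_density_kneser_3_1[OF that] unit_kernels.schatten6_nonneg[of "cut_off f"]
    by (cases "?S (cut_off f) = 0") (auto simp: graph_norm_def root_powr_inverse)
  have mult: "(\<lambda>z. c * f z) \<in> kernels" "cut_off (\<lambda>z. c * f z) = (\<lambda>z. c * cut_off f z)"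
    if "f \<in> kernels" for f c
  proof -
    have "(\<lambda>z. c * f z) ` ({0..1} \<times> {0..1}) = (\<lambda>x. c *\<^sub>R x) ` f ` ({0..1} \<times> {0..1})" by auto
    hence "bounded ((\<lambda>z. c * f z) ` ({0..1} \<times> {0..1}))"
      using that by (simp only: bounded_scaling kernels_def mem_Collect_eq)
    thus "(\<lambda>z. c * f z) \<in> kernels" using that by (auto simp: kernels_def)
  qed (auto simp: cut_off_def mult.assoc)
  have add: "(\<lambda>z. f z + g z) \<in> kernels" "cut_off (\<lambda>z. f z + g z) = (\<lambda>z. cut_off f z + cut_off g z)"
    if "f \<in> kernels" "g \<in> kernels" for f g
  proof -
    show "(\<lambda>z. f z + g z) \<in> kernels" using that by (auto simp: kernels_def intro: bounded_plus_comp)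
  qed (auto simp: cut_off_def distrib_right)
  have "seminorm_on kernels (graph_norm ?H)"
    unfolding seminorm_on_def
  proof (intro conjI ballI allI)
    fix f assume f: "f \<in> kernels"
    show "0 \<le> graph_norm ?H f" by (simp add: graph_norm_def)
    show "graph_norm ?H (\<lambda>z. c * f z) = \<bar>c\<bar> * graph_norm ?H f" for c
    proof -
      have "root 6 (c ^ 6) = \<bar>c\<bar>" using root_abs_power[of 6 c] by simp
      thus ?thesis
        unfolding norm[OF f] norm[OF mult(1)[OF f]] mult(2)[OF f]
          unit_kernels.schatten6_mult real_root_mult by simp
    qed
    show "graph_norm ?H (\<lambda>z. f z + g z) \<le> graph_norm ?H f + graph_norm ?H g" if g: "g \<in> kernels" for g
      unfolding norm[OF f] norm[OF g] norm[OF add(1)[OF f g]] add(2)[OF f g]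
      by (intro unit_kernels.schatten6_triangle cut_off_bounded_kernel f g)
  qed
  moreover have "AE z in unit_square. f z = 0" if f: "f \<in> kernels" and 0: "graph_norm ?H f = 0" for f
  proof -
    have "AE z in unit_square. cut_off f z = 0"
      using unit_kernels.schatten6_eq_0[OF cut_off_bounded_kernel[OF f]] 0 norm[OF f] by simp
    thus ?thesis
    proof (rule AE_mp)
      show "AE z in unit_square. cut_off f z = 0 \<longrightarrow> f z = 0"
        by (rule AE_I2) (auto simp: cut_off_def space_pair_measure)
    qed
  qed
  ultimately show ?thesis by (auto simp: norming_def)
qed

theorem theorem7p1:
  fixes n r :: nat
  assumes "n > 2 * r" and "2 * r \<ge> 2"
  shows "(norming (bipartite_kneser n r) \<longleftrightarrow> (n, r) = (3, 1)) \<and>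
         is_cycle 6 (bipartite_kneser 3 1)"
proof (intro conjI iffI)
  show "(n, r) = (3, 1)" if "norming (bipartite_kneser n r)"
    using bipartite_kneser_not_norming[of r n] assms that by linarith
  show "norming (bipartite_kneser n r)" if "(n, r) = (3, 1)"
    using norming_kneser_3_1 that by simp
  show "is_cycle 6 (bipartite_kneser 3 1)" by (rule is_cycle_kneser_3_1)
qed

end
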